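(* Let $f$ be an even entire function of order less than $2$ which is real on the real line and has only real roots. For $r>0$ let $n_+(r)$ be the number of real roots of $f$ in $[0,r]$, and assume that there exists $\alpha\in(0,2)$ such that for every $x>0$ $$\lim_{r\to\infty}\frac{n_+(xr)}{n_+(r)}=x^{\alpha}.$$ Define $$a_n=\left[\frac{1}{2n}\,n_+^{-1}\!\left(\frac{2n}{\pi\alpha\csc(\pi\alpha/2)}\right)\right]^2,\qquad n_+^{-1}(y)=\inf\{r>0: n_+(r)\ge y\}.$$ Then $$\lim_{n\to\infty}\frac{1}{f^{(2n)}(0)}\,f^{(2n)}(\sqrt{a_n}\,z)=\cos(z)$$ uniformly on compact subsets of the complex plane.
   Context: Roots are counted with multiplicity. $f^{(2n)}$ denotes the $2n$-th derivative of $f$, and $f^{(2n)}(\sqrt{a_n}z)$ is that derivative evaluated at $\sqrt{a_n}z$. The order of an entire function is the usual order of growth. The quantity $f^{(2n)}(0)$ is nonzero for all sufficiently large $n$, so the limit is meaningful. *)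

theory Defs
  imports "HOL-Complex_Analysis.Complex_Analysis"
begin

definition max_modulus :: "(complex \<Rightarrow> complex) \<Rightarrow> real \<Rightarrow> real" where
  "max_modulus f r = (SUP z\<in>sphere 0 r. norm (f z))"

text \<open>
  If \<open>max_modulus f\<close> is bounded (that is, \<open>f\<close> is constant), the iterated logarithm is a bounded
  function of \<open>r\<close> by the conventions \<open>ln 0 = 0\<close> and \<open>ln (-x) = ln x\<close>, so the order is
  \<open>0\<close>, as usual.
\<close>
definition entire_order :: "(complex \<Rightarrow> complex) \<Rightarrow> ereal" where
  "entire_order f = Limsup at_top (\<lambda>r. ereal (ln (ln (max_modulus f r)) / ln r))"

text \<open>
  Roots are counted with multiplicity, and a root at the origin is included. For entire \<open>f\<close> that
  is not identically zero the index set is finite and each \<open>zorder\<close> is positive.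
  For \<open>f = 0\<close> the index set is infinite, so the value is \<open>0\<close> for every \<open>r > 0\<close>.
\<close>
definition n_plus :: "(complex \<Rightarrow> complex) \<Rightarrow> real \<Rightarrow> nat" where
  "n_plus f r = (\<Sum>x | x \<in> {0..r} \<and> f (of_real x) = 0. nat (zorder f (of_real x)))"

definition n_plus_inv :: "(complex \<Rightarrow> complex) \<Rightarrow> real \<Rightarrow> real" where
  "n_plus_inv f y = Inf {r. r > 0 \<and> real (n_plus f r) \<ge> y}"

text \<open>The cosecant is written as the reciprocal of \<open>sin\<close>.\<close>
definition scale_seq :: "(complex \<Rightarrow> complex) \<Rightarrow> real \<Rightarrow> nat \<Rightarrow> real" where
  "scale_seq f \<alpha> n =
     (1 / (2 * real n) * n_plus_inv f (2 * real n / (pi * \<alpha> * (1 / sin (pi * \<alpha> / 2)))))\<^sup>2"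

end

theory Submission
  imports Defs
begin

text \<open>
  Replace \<open>z\<^sup>2\<close> by \<open>-w\<close>. Since \<open>f\<close> is even of order less than 2 with real roots, it becomes, up to a
  constant factor, a function \<open>h w = (\<Sum>n. e n * w ^ n)\<close> of order less than 1 whose roots are the
  numbers \<open>- x\<^sup>2 \<le> 0\<close>. Such a function has no exponential factor: \<open>h\<close> is the limit of the normalised
  products \<open>(\<Prod>x. (w + x\<^sup>2) / (1 + x\<^sup>2))\<close> over the roots \<open>x < R\<close> (\<open>truncated_prod_uniform_limit\<close>).
  Hence the \<open>e n\<close> are nonnegative limits of coefficients of polynomials with real roots of one sign,
  and \<open>f\<^sup>(\<^sup>2\<^sup>n\<^sup>) 0 = f \<i> * (2 n)! * (- 1) ^ n * e n\<close>.

  For a fixed \<open>t > 0\<close> the weights \<open>e n * t ^ n\<close>, divided by \<open>h t\<close>, form the distribution of a sum of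
  independent Bernoulli variables with success probabilities \<open>t / (t + x\<^sup>2)\<close>. Its mean is
  \<open>A t = (\<Sum>x. t / (t + x\<^sup>2))\<close>, and the mode and the mean of such a distribution differ by less than 1.
  At \<open>t = q n = e n / e (n + 1)\<close> both \<open>n\<close> and \<open>n + 1\<close> are modes, so that \<open>n \<le> A (q n) \<le> n + 1\<close>.
  This is \<open>coeff_ratio_mean_bounds\<close> for polynomials and \<open>mean_bounds\<close> for \<open>f\<close>; it follows in a few lines
  from the log-concavity of the coefficients. It turns the asymptotics of the derivatives at 0
  into those of a sum over the roots.

  That sum is an average of the counting function,
  \<open>A (s\<^sup>2) = \<integral> n\<^sub>+ (s * sqrt (1 / t - 1)) dt\<close> over \<open>0 < t < 1\<close>, up to a bounded error caused by a root at the
  origin. Regular variation and dominated convergence give \<open>A (s\<^sup>2) / n\<^sub>+ s \<longlongrightarrow> \<integral> (1 / t - 1) powr (\<alpha> / 2) dt\<close>, a Beta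
  integral with value \<open>(\<pi> \<alpha> / 2) / sin (\<pi> \<alpha> / 2)\<close> (\<open>level_mean_asymp\<close>). Inverting the counting function,
  \<open>q n\<close> is asymptotic to \<open>4 n\<^sup>2 * a\<^sub>n\<close> with the \<open>a\<^sub>n\<close> of the theorem, and \<open>q (n + 1) / q n \<longlongrightarrow> 1\<close>.

  The coefficient of \<open>z ^ (2 k)\<close> in \<open>f\<^sup>(\<^sup>2\<^sup>n\<^sup>) (sqrt a\<^sub>n * z) / f\<^sup>(\<^sup>2\<^sup>n\<^sup>) 0\<close> is \<open>(- 1) ^ k / (2 k)!\<close> times the product over
  \<open>j < k\<close> of \<open>a\<^sub>n * (2 n + 2 j + 2) * (2 n + 2 j + 1) / q (n + j)\<close>. Every factor tends to 1. As \<open>A t / t\<close> decreases, the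
  factors are also at most \<open>12 * (j + 1)\<close> for all large \<open>n\<close>, which is little enough for Tannery's theorem to
  give convergence to the series of the cosine, uniformly on bounded sets.
\<close>

section \<open>Coefficients of polynomials with nonpositive roots\<close>

text \<open>
  The hypothesis is the form of log-concavity that survives multiplication by a linear
  factor: the plain inequality \<open>p i * p (i + 2) \<le> (p (i + 1))\<^sup>2\<close> does not suffice when some
  coefficients vanish. Expanded in powers of \<open>l\<close>, the difference of the two sides has
  nonnegative coefficients: each is an instance of the hypothesis, a combination of two
  instances, or, for \<open>i = 0\<close>, a sum of products of coefficients.
\<close>
lemma log_concave_add_root:
  fixes p :: "real poly"
  assumes nn: "\<And>k. coeff p k \<ge> 0" and l: "l \<ge> 0"
    and lc: "\<And>i j. i \<le> j \<Longrightarrow> coeff p i * coeff p (j+2) \<le> coeff p (i+1) * coeff p (j+1)"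
    and ij: "i \<le> j"
  shows "coeff ([:l, 1:] * p) i * coeff ([:l, 1:] * p) (j+2)
       \<le> coeff ([:l, 1:] * p) (i+1) * coeff ([:l, 1:] * p) (j+1)"
proof -
  define a where "a = coeff p"
  have cS: "coeff ([:l, 1:] * p) (Suc k) = a k + l * a (Suc k)" for k
    by (simp add: a_def)
  have c0: "coeff ([:l, 1:] * p) 0 = l * a 0"
    by (simp add: a_def)
  have a0: "a k \<ge> 0" for k using nn a_def by simp
  have lc': "i \<le> j \<Longrightarrow> a i * a (Suc (Suc j)) \<le> a (Suc i) * a (Suc j)" for i j
    using lc[of i j] by (simp add: a_def)
  show ?thesis
  proof (cases i)
    case 0
    have 1: "l*l * (a 0 * a (Suc (Suc j))) \<le> l*l * (a (Suc 0) * a (Suc j))"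
      using lc'[of 0 j] l by (intro mult_left_mono) auto
    have 2: "0 \<le> a 0 * a j" "0 \<le> l * (a (Suc 0) * a j)" using a0 l by simp_all
    show ?thesis unfolding 0 add_2_eq_Suc' One_nat_def add_0_left Suc_eq_plus1[symmetric] c0 cS
      using 1 2 by (simp add: algebra_simps a_def)
  next
    case (Suc k)
    then obtain m where j: "j = Suc m" "k \<le> m" using ij by (cases j) auto
    have 1: "l*l * (a (Suc k) * a (Suc (Suc (Suc m)))) \<le> l*l * (a (Suc (Suc k)) * a (Suc (Suc m)))"
      using lc'[of "Suc k" "Suc m"] l j by (intro mult_left_mono) auto
    have 2: "a k * a (Suc (Suc m)) \<le> a (Suc k) * a (Suc m)" using lc'[of k m] j by auto
    have "a k * a (Suc (Suc (Suc m))) \<le> a (Suc k) * a (Suc (Suc m))"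
      using lc'[of k "Suc m"] j by auto
    also have "\<dots> \<le> a (Suc (Suc k)) * a (Suc m)"
    proof (cases "k = m")
      case False
      then show ?thesis using lc'[of "Suc k" m] j by auto
    qed simp
    finally have 3: "l * (a k * a (Suc (Suc (Suc m)))) \<le> l * (a (Suc (Suc k)) * a (Suc m))"
      using l by (intro mult_left_mono) auto
    show ?thesis unfolding Suc j add_2_eq_Suc' Suc_eq_plus1[symmetric] cS
      using 1 2 3 by (simp add: algebra_simps)
  qed
qed

text \<open>
  An indexed product rather than a multiset of roots, so that \<open>pderiv_prod\<close> applies. Roots are
  repeated by repeating values of \<open>l\<close>.
\<close>
definition neg_root_poly :: "('i \<Rightarrow> real) \<Rightarrow> 'i set \<Rightarrow> real poly" where
  "neg_root_poly l I = (\<Prod>i\<in>I. [:l i, 1:])"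

lemma neg_root_poly_coeff_nonneg:
  assumes "finite I" "\<And>i. i \<in> I \<Longrightarrow> l i \<ge> 0"
  shows "coeff (neg_root_poly l I) k \<ge> 0"
  using assms
proof (induction I arbitrary: k rule: finite_induct)
  case (insert x F)
  then show ?case
    by (cases k) (auto simp: neg_root_poly_def)
qed (auto simp: neg_root_poly_def)

lemma neg_root_poly_log_concave:
  assumes "finite I" "\<And>i. i \<in> I \<Longrightarrow> l i \<ge> 0" "i \<le> j"
  shows "coeff (neg_root_poly l I) i * coeff (neg_root_poly l I) (j+2)
       \<le> coeff (neg_root_poly l I) (i+1) * coeff (neg_root_poly l I) (j+1)"
  using assms
proof (induction I arbitrary: i j rule: finite_induct)
  case empty
  then show ?case by (simp add: neg_root_poly_def one_pCons)
next
  case (insert x F)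
  have eq: "neg_root_poly l (insert x F) = [:l x, 1:] * neg_root_poly l F"
    using insert by (simp add: neg_root_poly_def)
  show ?case unfolding eq
    by (rule log_concave_add_root) (use insert neg_root_poly_coeff_nonneg[of F l] in auto)
qed

text \<open>
  Compare coefficients in the product rule: each factor has derivative 1.
\<close>
lemma coeff_neg_root_poly_Suc:
  assumes "finite I"
  shows "real (Suc n) * coeff (neg_root_poly l I) (Suc n)
       = (\<Sum>i\<in>I. coeff (neg_root_poly l (I - {i})) n)"
proof -
  have "pderiv (neg_root_poly l I) = (\<Sum>i\<in>I. neg_root_poly l (I - {i}))"
    unfolding neg_root_poly_def by (simp add: pderiv_prod pderiv_pCons)
  then have "coeff (pderiv (neg_root_poly l I)) n = (\<Sum>i\<in>I. coeff (neg_root_poly l (I - {i})) n)"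
    by (simp add: coeff_sum)
  then show ?thesis by (simp add: coeff_pderiv)
qed

text \<open>
  With \<open>P = (w + l i) * P\<^sub>i\<close> and \<open>r\<close> the coefficients of \<open>P\<^sub>i\<close>, the previous lemma gives
  \<open>n + 1 = (\<Sum>i. r n / p (n + 1))\<close> and, one index lower, \<open>n = (\<Sum>i. r (n - 1) / p n)\<close>. So it is
  enough to bound \<open>q / (q + l i)\<close> above by \<open>r n / p (n + 1)\<close> and below by \<open>r (n - 1) / p n\<close>. After
  clearing denominators and inserting \<open>p k = r (k - 1) + l i * r k\<close>, both bounds are
  log-concavity of \<open>r\<close> at \<open>n\<close>.

  In terms of probability: a sum of independent Bernoulli variables for which \<open>n\<close> and \<open>n + 1\<close>
  are equally likely has mean between \<open>n\<close> and \<open>n + 1\<close>.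
\<close>
lemma coeff_ratio_mean_bounds:
  assumes I: "finite I" and l: "\<And>i. i \<in> I \<Longrightarrow> l i \<ge> 0"
    and pos: "coeff (neg_root_poly l I) n > 0" "coeff (neg_root_poly l I) (Suc n) > 0"
  defines "q \<equiv> coeff (neg_root_poly l I) n / coeff (neg_root_poly l I) (Suc n)"
  shows "real n \<le> (\<Sum>i\<in>I. q / (q + l i))" "(\<Sum>i\<in>I. q / (q + l i)) \<le> real (Suc n)"
proof -
  define p where "p = coeff (neg_root_poly l I)"
  define r where "r i = coeff (neg_root_poly l (I - {i}))" for i
  have p0: "p n > 0" "p (Suc n) > 0" and q: "q = p n / p (Suc n)" using pos by (auto simp: p_def q_def)
  have qpos: "q > 0" using p0 q by simp
  have peq: "neg_root_poly l I = [:l i, 1:] * neg_root_poly l (I - {i})" if "i \<in> I" for i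
    using I that by (simp add: neg_root_poly_def prod.remove)
  have pS: "p (Suc k) = r i k + l i * r i (Suc k)" if "i \<in> I" for i k
    unfolding p_def peq[OF that] r_def by simp
  have p00: "p 0 = l i * r i 0" if "i \<in> I" for i
    unfolding p_def peq[OF that] r_def by simp
  have r0: "r i k \<ge> 0" for i k unfolding r_def
    by (rule neg_root_poly_coeff_nonneg) (use I l in auto)
  have rlc: "r i k * r i (Suc (Suc k)) \<le> r i (Suc k) * r i (Suc k)" for i k
    using neg_root_poly_log_concave[of "I - {i}" l k k] I l by (simp add: r_def)
  have qi: "q / (q + l i) = p n / (p n + l i * p (Suc n))" if "i \<in> I" for i
  proof -
    have "q + l i = (p n + l i * p (Suc n)) / p (Suc n)" using p0 q by (simp add: field_simps)
    then show ?thesis using p0 q by simp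
  qed
  have den: "p n + l i * p (Suc n) > 0" if "i \<in> I" for i
    using p0 l[OF that] by (simp add: add_pos_nonneg)
  have up: "q / (q + l i) \<le> r i n / p (Suc n)" if i: "i \<in> I" for i
  proof -
    have "p n * p (Suc n) \<le> r i n * (p n + l i * p (Suc n))"
    proof (cases n)
      case 0
      have "0 \<le> l i * (r i 0 * r i 0)" using r0 l[OF i] by simp
      then show ?thesis using 0 p00[OF i] pS[OF i, of 0] by (simp add: algebra_simps)
    next
      case (Suc k)
      have "l i * (r i k * r i (Suc (Suc k))) \<le> l i * (r i (Suc k) * r i (Suc k))"
        using rlc l[OF i] by (intro mult_left_mono) auto
      then show ?thesis unfolding Suc pS[OF i] by (simp add: algebra_simps)
    qed
    then show ?thesis unfolding qi[OF i] using p0 den[OF i] by (simp add: field_simps)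
  qed
  have "(\<Sum>i\<in>I. q / (q + l i)) \<le> (\<Sum>i\<in>I. r i n / p (Suc n))"
    by (intro sum_mono up)
  also have "\<dots> = real (Suc n)"
    using coeff_neg_root_poly_Suc[OF I, of n l] p0 unfolding p_def r_def
    by (simp add: sum_divide_distrib[symmetric] field_simps)
  finally show "(\<Sum>i\<in>I. q / (q + l i)) \<le> real (Suc n)" .
  show "real n \<le> (\<Sum>i\<in>I. q / (q + l i))"
  proof (cases n)
    case 0
    then show ?thesis using qpos l by (auto intro!: sum_nonneg divide_nonneg_pos add_pos_nonneg)
  next
    case (Suc k)
    have lo: "r i k / p n \<le> q / (q + l i)" if i: "i \<in> I" for i
    proof -
      have "l i * l i * (r i k * r i (Suc (Suc k))) \<le> l i * l i * (r i (Suc k) * r i (Suc k))"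
        using rlc l[OF i] by (intro mult_left_mono) auto
      then have "r i k * (p n + l i * p (Suc n)) \<le> p n * p n"
        unfolding Suc pS[OF i] by (simp add: algebra_simps)
      then show ?thesis unfolding qi[OF i] using p0 den[OF i] by (simp add: field_simps)
    qed
    have "real n = (\<Sum>i\<in>I. r i k / p n)"
      using coeff_neg_root_poly_Suc[OF I, of k l] p0 unfolding Suc p_def r_def
      by (simp add: sum_divide_distrib[symmetric] field_simps)
    also have "\<dots> \<le> (\<Sum>i\<in>I. q / (q + l i))"
      by (intro sum_mono lo)
    finally show ?thesis .
  qed
qed

section \<open>Regularly varying functions\<close>

lemma Beta_reflection:
  fixes \<rho> :: real
  assumes "0 < \<rho>" "\<rho> < 1"
  shows "Beta (1 - \<rho>) (1 + \<rho>) = pi * \<rho> / sin (pi * \<rho>)"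
proof -
  have 1: "complex_of_real (Gamma \<rho> * Gamma (1 - \<rho>)) = complex_of_real (pi / sin (pi * \<rho>))"
    using Gamma_reflection_complex[of "of_real \<rho>"]
    by (simp add: Gamma_complex_of_real[symmetric] sin_of_real[symmetric])
  have "Gamma \<rho> * Gamma (1 - \<rho>) = pi / sin (pi * \<rho>)"
    using 1 by (simp only: of_real_eq_iff)
  moreover have "Gamma (1 + \<rho>) = \<rho> * Gamma \<rho>"
  proof -
    have "\<rho> \<notin> \<int>\<^sub>\<le>\<^sub>0" using assms by (auto elim!: nonpos_Ints_cases)
    then show ?thesis using Gamma_plus1[of \<rho>] by (simp add: add.commute)
  qed
  moreover have "Gamma (2::real) = 1" using Gamma_fact[of 1] by simp
  ultimately show ?thesis by (simp add: Beta_def field_simps)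
qed

lemma regularly_varying_eventually_pos:
  fixes M :: "real \<Rightarrow> real"
  assumes nn: "\<And>x. M x \<ge> 0"
    and rv: "\<And>x. x > 0 \<Longrightarrow> ((\<lambda>r. M (x * r) / M r) \<longlongrightarrow> x powr \<alpha>) at_top"
  shows "eventually (\<lambda>r. M r > 0) at_top"
proof -
  have "eventually (\<lambda>r. M (1 * r) / M r > 0) at_top"
    using order_tendstoD(1)[OF rv[of 1], of 0] by simp
  then show ?thesis
    by eventually_elim (use nn in \<open>metis divide_eq_0_iff less_eq_real_def less_irrefl\<close>)
qed

text \<open>
  A bound of Potter type, obtained by iterating \<open>M (2 * s) \<le> 2 powr \<beta> * M s\<close>. It serves as the
  dominating function for \<open>M (s * u) / M s\<close>.
\<close>
lemma regularly_varying_bound: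
  fixes M :: "real \<Rightarrow> real"
  assumes mono: "mono M" and nn: "\<And>x. M x \<ge> 0"
    and rv: "\<And>x. x > 0 \<Longrightarrow> ((\<lambda>r. M (x * r) / M r) \<longlongrightarrow> x powr \<alpha>) at_top"
    and \<beta>: "\<alpha> < \<beta>" "\<beta> > 0"
  shows "\<exists>s0>0. \<forall>s\<ge>s0. M s > 0 \<and> (\<forall>u\<ge>0. M (s * u) \<le> 2 powr \<beta> * (1 + u powr \<beta>) * M s)"
proof -
  have "eventually (\<lambda>r. M (2 * r) / M r < 2 powr \<beta>) at_top"
    using order_tendstoD(2)[OF rv[of 2], of "2 powr \<beta>"] \<beta> by simp
  moreover have "eventually (\<lambda>r. M r > 0) at_top"
    by (rule regularly_varying_eventually_pos[of M \<alpha>]) (use nn rv in auto)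
  ultimately have "eventually (\<lambda>r. M (2 * r) / M r < 2 powr \<beta> \<and> M r > 0) at_top"
    by eventually_elim auto
  then obtain s1 where s1: "\<And>s. s \<ge> s1 \<Longrightarrow> M (2 * s) / M s < 2 powr \<beta> \<and> M s > 0"
    unfolding eventually_at_top_linorder by blast
  have s2: "M (2 * s) \<le> 2 powr \<beta> * M s" if "s \<ge> s1" for s
    using s1[OF that] by (metis less_imp_le pos_divide_less_eq)
  define s0 where "s0 = max s1 1"
  have s0: "s0 > 0" "\<And>s. s \<ge> s0 \<Longrightarrow> M s > 0" "\<And>s. s \<ge> s0 \<Longrightarrow> M (2 * s) \<le> 2 powr \<beta> * M s"
    using s1 s2 unfolding s0_def by auto
  have it: "M (2 ^ k * s) \<le> 2 powr (real k * \<beta>) * M s" if "s \<ge> s0" for k s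
  proof (induction k)
    case (Suc k)
    have "2 ^ k * s \<ge> 1 * s" using that s0(1) by (intro mult_right_mono) auto
    then have "M (2 * (2 ^ k * s)) \<le> 2 powr \<beta> * M (2 ^ k * s)"
      using s0(3)[of "2 ^ k * s"] that by simp
    also have "\<dots> \<le> 2 powr \<beta> * (2 powr (real k * \<beta>) * M s)"
      using Suc by (intro mult_left_mono) auto
    finally show ?case by (simp add: powr_add[symmetric] algebra_simps)
  qed simp
  have "M (s * u) \<le> 2 powr \<beta> * (1 + u powr \<beta>) * M s" if s: "s \<ge> s0" and u: "u \<ge> 0" for s u
  proof (cases "u \<le> 1")
    case True
    have "M (s * u) \<le> M s"
      using True s s0(1) u by (intro monoD[OF mono]) (auto simp: mult_left_le)
    also have "\<dots> = 1 * 1 * M s" by simp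
    also have "\<dots> \<le> 2 powr \<beta> * (1 + u powr \<beta>) * M s"
      using nn \<beta> by (intro mult_mono) (auto simp: ge_one_powr_ge_zero)
    finally show ?thesis .
  next
    case False
    define k where "k = nat \<lceil>log 2 u\<rceil>"
    have lu: "log 2 u > 0" using False by simp
    have k1: "real k < log 2 u + 1" and k2: "log 2 u \<le> real k"
      unfolding k_def using lu by linarith+
    have "u = 2 powr log 2 u" using False by simp
    also have "\<dots> \<le> 2 powr real k" using k2 by simp
    also have "\<dots> = 2 ^ k" by (simp add: powr_realpow)
    finally have "M (s * u) \<le> M (2 ^ k * s)"
      using s s0(1) by (intro monoD[OF mono]) (simp add: mult.commute)
    also have "\<dots> \<le> 2 powr (real k * \<beta>) * M s" by (rule it[OF s])
    also have "\<dots> \<le> (2 powr \<beta> * (1 + u powr \<beta>)) * M s"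
    proof (intro mult_right_mono nn)
      have "2 powr (real k * \<beta>) \<le> 2 powr ((log 2 u + 1) * \<beta>)"
        using k1 \<beta> by simp
      also have "\<dots> = 2 powr \<beta> * (2 powr (log 2 u)) powr \<beta>"
        by (simp add: powr_powr powr_add algebra_simps)
      also have "\<dots> = 2 powr \<beta> * u powr \<beta>" using False by simp
      also have "\<dots> \<le> 2 powr \<beta> * (1 + u powr \<beta>)" by simp
      finally show "2 powr (real k * \<beta>) \<le> 2 powr \<beta> * (1 + u powr \<beta>)" .
    qed
    finally show ?thesis .
  qed
  with s0 show ?thesis by blast
qed

text \<open>
  If \<open>M (s n)\<close> is asymptotic to \<open>y n\<close>, then \<open>s n\<close> is an asymptotic inverse: stretching or
  shrinking the argument by a factor \<open>e > 1\<close> moves \<open>M\<close> past \<open>y n\<close>, because it multiplies \<open>M\<close> by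
  about \<open>e powr \<alpha>\<close>.
\<close>
lemma regularly_varying_squeeze:
  fixes M :: "real \<Rightarrow> real"
  assumes \<alpha>: "\<alpha> > 0"
    and rv: "\<And>x. x > 0 \<Longrightarrow> ((\<lambda>r. M (x * r) / M r) \<longlongrightarrow> x powr \<alpha>) at_top"
    and s: "filterlim s at_top F" and y: "eventually (\<lambda>n. y n > 0) F"
    and M: "((\<lambda>n. M (s n) / y n) \<longlongrightarrow> 1) F" and e: "e > 1"
  shows "eventually (\<lambda>n. M (s n / e) < y n) F" "eventually (\<lambda>n. y n < M (e * s n)) F"
proof -
  have nz: "eventually (\<lambda>n. M (s n) / y n > 0) F"
    using order_tendstoD(1)[OF M, of 0] by simp
  have lim: "((\<lambda>n. M (x * s n) / y n) \<longlongrightarrow> x powr \<alpha>) F" if "x > 0" for x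
  proof -
    have "((\<lambda>n. M (x * s n) / M (s n) * (M (s n) / y n)) \<longlongrightarrow> x powr \<alpha> * 1) F"
      by (intro tendsto_mult M filterlim_compose[OF rv[OF that] s])
    then have "((\<lambda>n. M (x * s n) / M (s n) * (M (s n) / y n)) \<longlongrightarrow> x powr \<alpha>) F" by simp
    then show ?thesis
      by (rule Lim_transform_eventually) (use nz in eventually_elim, auto)
  qed
  have "(1 / e) powr \<alpha> < 1" using e \<alpha> by (simp add: powr_less_one powr_divide gr_one_powr)
  then have "eventually (\<lambda>n. M (1 / e * s n) / y n < 1) F"
    using order_tendstoD(2)[OF lim[of "1/e"], of 1] e by simp
  with y show "eventually (\<lambda>n. M (s n / e) < y n) F" by eventually_elim auto
  have "e powr \<alpha> > 1" using e \<alpha> by (simp add: gr_one_powr)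
  then have "eventually (\<lambda>n. M (e * s n) / y n > 1) F"
    using order_tendstoD(1)[OF lim[of e], of 1] e by simp
  with y show "eventually (\<lambda>n. y n < M (e * s n)) F" by eventually_elim auto
qed

lemma Beta_integral_level:
  fixes \<rho> :: real
  assumes "-1 < \<rho>" "\<rho> < 1"
  shows "set_integrable lborel {0<..<1} (\<lambda>t. (1 / t - 1) powr \<rho>)"
    and "(LINT t:{0<..<1}|lborel. (1 / t - 1) powr \<rho>) = Beta (1 - \<rho>) (1 + \<rho>)"
proof -
  let ?g = "\<lambda>t::real. t powr ((1 - \<rho>) - 1) * (1 - t) powr ((1 + \<rho>) - 1)"
  have eq: "(1 / t - 1) powr \<rho> = ?g t" if "t \<in> {0<..<1}" for t
  proof -
    have "1 / t - 1 = (1 - t) / t" using that by (simp add: field_simps)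
    then show ?thesis using that by (simp add: powr_divide powr_minus field_simps)
  qed
  have int: "set_integrable lborel {0..1} ?g"
    by (rule integrable_Beta) (use assms in auto)
  have int': "set_integrable lborel {0<..<1} ?g"
    by (rule set_integrable_subset[OF int]) auto
  show "set_integrable lborel {0<..<1} (\<lambda>t. (1 / t - 1) powr \<rho>)"
    using int' by (subst set_integrable_cong[OF refl refl eq]) auto
  have "(LINT t:{0<..<1}|lborel. (1 / t - 1) powr \<rho>) = (LINT t:{0<..<1}|lborel. ?g t)"
    by (rule set_lebesgue_integral_cong) (use eq in auto)
  also have "\<dots> = integral {0<..<1} ?g"
    by (rule set_borel_integral_eq_integral[OF int'])
  also have "\<dots> = integral {0..1} ?g"
    by (rule integral_open_interval_real[symmetric])
  also have "\<dots> = Beta (1 - \<rho>) (1 + \<rho>)"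
    by (intro integral_unique has_integral_Beta_real) (use assms in auto)
  finally show "(LINT t:{0<..<1}|lborel. (1 / t - 1) powr \<rho>) = Beta (1 - \<rho>) (1 + \<rho>)" .
qed

text \<open>
  The substitution \<open>t = 1 / (1 + u\<^sup>2)\<close> in \<open>\<integral> M (s * u) * 2 * u / (1 + u\<^sup>2)\<^sup>2 du\<close>, which is the
  Stieltjes integral \<open>\<integral> s\<^sup>2 / (s\<^sup>2 + x\<^sup>2) dM x\<close> integrated by parts. The values of \<open>t\<close> are the
  levels of the kernel \<open>s\<^sup>2 / (s\<^sup>2 + x\<^sup>2)\<close>.
\<close>
definition level_mean :: "(real \<Rightarrow> real) \<Rightarrow> real \<Rightarrow> real" where
  "level_mean M s = (LINT t:{0<..<1}|lborel. M (s * sqrt (1 / t - 1)))"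

lemma level_integrand_measurable:
  fixes M :: "real \<Rightarrow> real"
  assumes "mono M"
  shows "(\<lambda>t. M (s * sqrt (1 / t - 1))) \<in> borel_measurable borel"
proof -
  have [measurable]: "M \<in> borel_measurable borel" by (rule borel_measurable_mono[OF assms])
  show ?thesis by measurable
qed

lemma level_integrand_integrable:
  fixes M :: "real \<Rightarrow> real"
  assumes mono: "mono M" and nn: "\<And>x. M x \<ge> 0"
    and rv: "\<And>x. x > 0 \<Longrightarrow> ((\<lambda>r. M (x * r) / M r) \<longlongrightarrow> x powr \<alpha>) at_top"
    and \<alpha>: "0 < \<alpha>" "\<alpha> < 2" and s: "s > 0"
  shows "set_integrable lborel {0<..<1} (\<lambda>t. M (s * sqrt (1 / t - 1)))"
proof -
  define \<beta> where "\<beta> = (\<alpha> + 2) / 2"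
  have \<beta>: "\<alpha> < \<beta>" "\<beta> > 0" "\<beta> < 2" using \<alpha> by (auto simp: \<beta>_def)
  from regularly_varying_bound[OF mono nn rv \<beta>(1,2)] obtain s0 where s0: "s0 > 0"
    "\<And>s u. s \<ge> s0 \<Longrightarrow> u \<ge> 0 \<Longrightarrow> M (s * u) \<le> 2 powr \<beta> * (1 + u powr \<beta>) * M s" by blast
  \<comment> \<open>The bound holds for large arguments only; monotonicity extends integrability to all \<open>s > 0\<close>.\<close>
  define S where "S = max s s0"
  have i1: "set_integrable lborel {0<..<1} (\<lambda>t::real. (1 / t - 1) powr (\<beta> / 2))"
    by (rule Beta_integral_level) (use \<beta> in auto)
  have i2: "set_integrable lborel {0<..<1} (\<lambda>t::real. 1::real)"
    by (simp add: set_integrable_def)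
  have "set_integrable lborel {0<..<1} (\<lambda>t. (2 powr \<beta> * M S) * (1 + (1 / t - 1) powr (\<beta> / 2)))"
    by (intro set_integrable_mult_right set_integral_add(1) i1 i2)
  then show ?thesis
  proof (rule set_integrable_bound)
    show "set_borel_measurable lborel {0<..<1} (\<lambda>t. M (s * sqrt (1 / t - 1)))"
      unfolding set_borel_measurable_def using level_integrand_measurable[OF mono]
      by (intro borel_measurable_scaleR borel_measurable_indicator) auto
    show "AE t in lborel. t \<in> {0<..<1} \<longrightarrow> norm (M (s * sqrt (1 / t - 1)))
            \<le> norm (2 powr \<beta> * M S * (1 + (1 / t - 1) powr (\<beta> / 2)))"
    proof (intro AE_I2 impI)
      fix t :: real assume t: "t \<in> {0<..<1}"
      have t1: "1 / t - 1 > 0" using t by (auto simp: field_simps)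
      have "M (s * sqrt (1 / t - 1)) \<le> M (S * sqrt (1 / t - 1))"
        using t1 by (intro monoD[OF mono] mult_right_mono) (auto simp: S_def)
      also have "\<dots> \<le> 2 powr \<beta> * (1 + sqrt (1 / t - 1) powr \<beta>) * M S"
        using t1 by (intro s0(2)) (auto simp: S_def)
      also have "sqrt (1 / t - 1) powr \<beta> = (1 / t - 1) powr (\<beta> / 2)"
        using t1 by (simp add: powr_half_sqrt[symmetric] powr_powr)
      finally show "norm (M (s * sqrt (1 / t - 1)))
            \<le> norm (2 powr \<beta> * M S * (1 + (1 / t - 1) powr (\<beta> / 2)))"
        using nn by (simp add: abs_mult mult_ac)
    qed
  qed
qed

text \<open>
  Divided by \<open>M s\<close>, the integrand tends to \<open>(1 / t - 1) powr (\<alpha> / 2)\<close> by regular variation. It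
  is dominated by the bound of Potter type for an exponent \<open>\<beta>\<close> with \<open>\<alpha> < \<beta> < 2\<close>; it is \<open>\<beta> < 2\<close>
  that makes the dominating function integrable at \<open>t = 0\<close>.
\<close>
lemma level_mean_asymp:
  fixes M :: "real \<Rightarrow> real"
  assumes mono: "mono M" and nn: "\<And>x. M x \<ge> 0"
    and rv: "\<And>x. x > 0 \<Longrightarrow> ((\<lambda>r. M (x * r) / M r) \<longlongrightarrow> x powr \<alpha>) at_top"
    and \<alpha>: "0 < \<alpha>" "\<alpha> < 2"
  shows "((\<lambda>s. level_mean M s / M s) \<longlongrightarrow> pi * (\<alpha> / 2) / sin (pi * (\<alpha> / 2))) at_top"
proof -
  define \<beta> where "\<beta> = (\<alpha> + 2) / 2"
  have \<beta>: "\<alpha> < \<beta>" "\<beta> > 0" "\<beta> < 2" using \<alpha> by (auto simp: \<beta>_def)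
  from regularly_varying_bound[OF mono nn rv \<beta>(1,2)] obtain s0 where s0: "s0 > 0"
    "\<And>s. s \<ge> s0 \<Longrightarrow> M s > 0"
    "\<And>s u. s \<ge> s0 \<Longrightarrow> u \<ge> 0 \<Longrightarrow> M (s * u) \<le> 2 powr \<beta> * (1 + u powr \<beta>) * M s" by blast
  have i1: "set_integrable lborel {0<..<1} (\<lambda>t::real. (1 / t - 1) powr (\<beta> / 2))"
    by (rule Beta_integral_level) (use \<beta> in auto)
  have i2: "set_integrable lborel {0<..<1} (\<lambda>t::real. 1::real)"
    by (simp add: set_integrable_def)
  have int: "set_integrable lborel {0<..<1} (\<lambda>t. 2 powr \<beta> * (1 + (1 / t - 1) powr (\<beta> / 2)))"
    by (intro set_integrable_mult_right set_integral_add(1) i1 i2)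
  let ?I = "indicator {0<..<1} :: real \<Rightarrow> real"
  have "((\<lambda>s. \<integral>t. ?I t * (M (s * sqrt (1 / t - 1)) / M s) \<partial>lborel)
      \<longlongrightarrow> (\<integral>t. ?I t * (1 / t - 1) powr (\<alpha> / 2) \<partial>lborel)) at_top"
  proof (rule integral_dominated_convergence_at_top)
    show "(\<lambda>t. ?I t * (1 / t - 1) powr (\<alpha> / 2)) \<in> borel_measurable lborel" by measurable
    show "(\<lambda>t. ?I t * (M (s * sqrt (1 / t - 1)) / M s)) \<in> borel_measurable lborel" for s
      using level_integrand_measurable[OF mono] by (intro borel_measurable_times borel_measurable_divide) auto
    show "integrable lborel (\<lambda>t. ?I t * (2 powr \<beta> * (1 + (1 / t - 1) powr (\<beta> / 2))))"
      using int by (simp add: set_integrable_def)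
    show "\<forall>\<^sub>F s in at_top. AE t in lborel. norm (?I t * (M (s * sqrt (1 / t - 1)) / M s))
            \<le> ?I t * (2 powr \<beta> * (1 + (1 / t - 1) powr (\<beta> / 2)))"
      using eventually_ge_at_top[of s0]
    proof eventually_elim
      case (elim s)
      show ?case
      proof (intro AE_I2)
        fix t :: real
        show "norm (?I t * (M (s * sqrt (1 / t - 1)) / M s))
            \<le> ?I t * (2 powr \<beta> * (1 + (1 / t - 1) powr (\<beta> / 2)))"
        proof (cases "t \<in> {0<..<1}")
          case t: True
          have t1: "1 / t - 1 > 0" using t by (auto simp: field_simps)
          have "M (s * sqrt (1 / t - 1)) \<le> 2 powr \<beta> * (1 + sqrt (1 / t - 1) powr \<beta>) * M s"
            using t1 elim by (intro s0(3)) auto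
          also have "sqrt (1 / t - 1) powr \<beta> = (1 / t - 1) powr (\<beta> / 2)"
            using t1 by (simp add: powr_half_sqrt[symmetric] powr_powr)
          finally show ?thesis using s0(2)[OF elim] nn[of "s * sqrt (1 / t - 1)"] t
            by (simp add: field_simps)
        qed auto
      qed
    qed
    show "AE t in lborel. ((\<lambda>s. ?I t * (M (s * sqrt (1 / t - 1)) / M s)) \<longlongrightarrow>
              ?I t * (1 / t - 1) powr (\<alpha> / 2)) at_top"
    proof (intro AE_I2)
      fix t :: real
      show "((\<lambda>s. ?I t * (M (s * sqrt (1 / t - 1)) / M s)) \<longlongrightarrow>
              ?I t * (1 / t - 1) powr (\<alpha> / 2)) at_top"
      proof (cases "t \<in> {0<..<1}")
        case t: True
        have t1: "1 / t - 1 > 0" using t by (auto simp: field_simps)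
        have "((\<lambda>s. M (sqrt (1 / t - 1) * s) / M s) \<longlongrightarrow> sqrt (1 / t - 1) powr \<alpha>) at_top"
          using t1 by (intro rv) auto
        also have "sqrt (1 / t - 1) powr \<alpha> = (1 / t - 1) powr (\<alpha> / 2)"
          using t1 by (simp add: powr_half_sqrt[symmetric] powr_powr)
        finally show ?thesis using t by (simp add: mult.commute)
      qed auto
    qed
  qed
  also have "(\<integral>t. ?I t * (1 / t - 1) powr (\<alpha> / 2) \<partial>lborel) = Beta (1 - \<alpha> / 2) (1 + \<alpha> / 2)"
    using Beta_integral_level(2)[of "\<alpha> / 2"] \<alpha> by (simp add: set_lebesgue_integral_def)
  also have "\<dots> = pi * (\<alpha> / 2) / sin (pi * (\<alpha> / 2))"
    by (rule Beta_reflection) (use \<alpha> in auto)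
  also have "(\<lambda>s. \<integral>t. ?I t * (M (s * sqrt (1 / t - 1)) / M s) \<partial>lborel) = (\<lambda>s. level_mean M s / M s)"
    by (simp add: level_mean_def set_lebesgue_integral_def)
  finally show ?thesis .
qed

text \<open>
  Doubling the argument multiplies \<open>M\<close> by at least a fixed factor \<open>c > 1\<close> from some point on.
\<close>
lemma regularly_varying_at_top:
  fixes M :: "real \<Rightarrow> real"
  assumes mono: "mono M" and nn: "\<And>x. M x \<ge> 0" and \<alpha>: "\<alpha> > 0"
    and rv: "\<And>x. x > 0 \<Longrightarrow> ((\<lambda>r. M (x * r) / M r) \<longlongrightarrow> x powr \<alpha>) at_top"
  shows "filterlim M at_top at_top"
proof -
  define c where "c = (1 + 2 powr \<alpha>) / 2"
  have "2 powr \<alpha> > 1" using \<alpha> by (simp add: gr_one_powr)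
  then have c: "1 < c" "c < 2 powr \<alpha>" by (auto simp: c_def)
  have "eventually (\<lambda>r. M (2 * r) / M r > c) at_top"
    using order_tendstoD(1)[OF rv[of 2], of c] c by simp
  moreover have "eventually (\<lambda>r. M r > 0) at_top"
    by (rule regularly_varying_eventually_pos[of M \<alpha>]) (use nn rv in auto)
  ultimately have "eventually (\<lambda>r. M r > 0 \<and> c * M r \<le> M (2 * r)) at_top"
    by eventually_elim (simp add: pos_less_divide_eq less_imp_le)
  then obtain r0 where r0: "\<And>r. r \<ge> r0 \<Longrightarrow> M r > 0 \<and> c * M r \<le> M (2 * r)"
    unfolding eventually_at_top_linorder by blast
  define r where "r = max r0 1"
  have r: "r \<ge> r0" "r \<ge> 1" by (auto simp: r_def)
  have it: "c ^ k * M r \<le> M (2 ^ k * r)" for k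
  proof (induction k)
    case (Suc k)
    have "2 ^ k * r \<ge> 1 * r" using r by (intro mult_right_mono) auto
    then have "2 ^ k * r \<ge> r0" using r by linarith
    then have "c * M (2 ^ k * r) \<le> M (2 * (2 ^ k * r))" using r0 by blast
    moreover have "c * (c ^ k * M r) \<le> c * M (2 ^ k * r)" using Suc c by (intro mult_left_mono) auto
    ultimately show ?case by (simp add: mult_ac)
  qed simp
  show ?thesis unfolding filterlim_at_top
  proof
    fix C :: real
    have Mr: "M r > 0" using r0 r by auto
    obtain k where k: "C / M r < c ^ k" using real_arch_pow[OF c(1)] by blast
    then have "C \<le> c ^ k * M r" using Mr by (simp add: pos_divide_less_eq less_imp_le)
    then have "C \<le> M x" if "x \<ge> 2 ^ k * r" for x
      using it[of k] monoD[OF mono that] by linarith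
    then show "eventually (\<lambda>x. C \<le> M x) at_top"
      unfolding eventually_at_top_linorder by blast
  qed
qed

section \<open>Averages of counting functions\<close>

text \<open>
  The layer-cake formula for a single point mass: \<open>x \<le> s * sqrt (1 / t - 1)\<close> says that the
  level \<open>t\<close> does not exceed the value \<open>s\<^sup>2 / (s\<^sup>2 + x\<^sup>2)\<close> of the kernel at \<open>x\<close>.
\<close>
lemma level_mean_step:
  assumes "x \<ge> 0" "s > (0::real)"
  shows "set_integrable lborel {0<..<1} (\<lambda>t. (if x \<le> s * sqrt (1 / t - 1) then 1 else 0) :: real)"
    and "(LINT t:{0<..<1}|lborel. (if x \<le> s * sqrt (1 / t - 1) then 1 else 0)) = s\<^sup>2 / (s\<^sup>2 + x\<^sup>2)"
proof -
  define \<phi> where "\<phi> = s\<^sup>2 / (s\<^sup>2 + x\<^sup>2)"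
  have den: "s\<^sup>2 + x\<^sup>2 > 0" using assms by (simp add: add_pos_nonneg)
  have \<phi>: "0 < \<phi>" "\<phi> \<le> 1" using assms den by (auto simp: \<phi>_def)
  have iff: "x \<le> s * sqrt (1 / t - 1) \<longleftrightarrow> t \<le> \<phi>" if t: "t \<in> {0<..<1}" for t
  proof -
    have t1: "1 / t - 1 > 0" using t by (auto simp: field_simps)
    have "x \<le> s * sqrt (1 / t - 1) \<longleftrightarrow> x\<^sup>2 \<le> (s * sqrt (1 / t - 1))\<^sup>2"
      using assms t1 by (intro power2_le_iff_abs_le[THEN sym, THEN trans] iffI) auto
    also have "(s * sqrt (1 / t - 1))\<^sup>2 = s\<^sup>2 * (1 / t - 1)"
      using t1 by (simp add: power_mult_distrib)
    also have "x\<^sup>2 \<le> s\<^sup>2 * (1 / t - 1) \<longleftrightarrow> t \<le> \<phi>"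
      using t den unfolding \<phi>_def by (simp add: field_simps)
    finally show ?thesis .
  qed
  define B where "B = {0<..<1} \<inter> {..\<phi>}"
  have eq: "indicator {0<..<1} t *\<^sub>R ((if x \<le> s * sqrt (1 / t - 1) then 1 else 0) :: real)
      = indicator B t" for t
    using iff[of t] by (cases "t \<in> {0<..<1}") (auto simp: B_def indicator_def)
  have B: "B \<in> sets lborel" by (simp add: B_def)
  have em: "emeasure lborel B = ennreal \<phi>"
  proof (cases "\<phi> = 1")
    case True
    then have "B = {0<..<1}" by (auto simp: B_def)
    then show ?thesis using True by simp
  next
    case False
    then have "B = {0<..\<phi>}" using \<phi> by (auto simp: B_def)
    then show ?thesis using \<phi> by simp
  qed
  show "set_integrable lborel {0<..<1} (\<lambda>t. (if x \<le> s * sqrt (1 / t - 1) then 1 else 0) :: real)"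
    unfolding set_integrable_def eq using B em by (simp add: integrable_indicator_iff)
  have "measure lborel B = \<phi>" using em \<phi> by (simp add: measure_def)
  then show "(LINT t:{0<..<1}|lborel. (if x \<le> s * sqrt (1 / t - 1) then 1 else 0)) = s\<^sup>2 / (s\<^sup>2 + x\<^sup>2)"
    unfolding set_lebesgue_integral_def eq \<phi>_def[symmetric] using B by simp
qed

lemma level_mean_finite_sum:
  assumes "finite Z" "\<And>x. x \<in> Z \<Longrightarrow> x \<ge> 0" "s > (0::real)"
  shows "level_mean (\<lambda>y. \<Sum>x\<in>Z. \<mu> x * (if x \<le> y then 1 else 0)) s = (\<Sum>x\<in>Z. \<mu> x * (s\<^sup>2 / (s\<^sup>2 + x\<^sup>2)))"
proof -
  have "level_mean (\<lambda>y. \<Sum>x\<in>Z. \<mu> x * (if x \<le> y then 1 else 0)) s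
      = (\<Sum>x\<in>Z. LINT t:{0<..<1}|lborel. \<mu> x * (if x \<le> s * sqrt (1 / t - 1) then 1 else 0))"
    unfolding level_mean_def set_lebesgue_integral_def scaleR_sum_right
  proof (rule Bochner_Integration.integral_sum)
    fix x assume "x \<in> Z"
    then have "set_integrable lborel {0<..<1} (\<lambda>t. \<mu> x * (if x \<le> s * sqrt (1 / t - 1) then 1 else 0))"
      by (intro set_integrable_mult_right level_mean_step) (use assms in auto)
    then show "integrable lborel
       (\<lambda>t. indicator {0<..<1} t *\<^sub>R (\<mu> x * (if x \<le> s * sqrt (1 / t - 1) then 1 else 0)))"
      unfolding set_integrable_def .
  qed
  also have "\<dots> = (\<Sum>x\<in>Z. \<mu> x * (s\<^sup>2 / (s\<^sup>2 + x\<^sup>2)))"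
    by (intro sum.cong refl, subst set_integral_mult_right, subst level_mean_step) (use assms in auto)
  finally show ?thesis .
qed

text \<open>
  The infinite sum \<open>(\<Sum>x\<in>Z. \<mu> x * s\<^sup>2 / (s\<^sup>2 + x\<^sup>2))\<close> converges to the integral mean of the
  counting function \<open>M\<close>: the partial sums are the means of truncated counting functions,
  which increase to \<open>M\<close> and are dominated by it.
\<close>
lemma level_mean_counting:
  fixes Z :: "real set" and \<mu> :: "real \<Rightarrow> real"
  assumes Z: "\<And>x. x \<in> Z \<Longrightarrow> x \<ge> 0" and fin: "\<And>r. finite {x\<in>Z. x \<le> r}"
    and \<mu>: "\<And>x. \<mu> x \<ge> 0"
  defines "M \<equiv> (\<lambda>y. \<Sum>x\<in>{x\<in>Z. x \<le> y}. \<mu> x)"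
  assumes rv: "\<And>x. x > 0 \<Longrightarrow> ((\<lambda>r. M (x * r) / M r) \<longlongrightarrow> x powr \<alpha>) at_top"
    and \<alpha>: "0 < \<alpha>" "\<alpha> < 2" and s: "s > 0"
  shows "(\<lambda>k. \<Sum>x\<in>{x\<in>Z. x < real k}. \<mu> x * (s\<^sup>2 / (s\<^sup>2 + x\<^sup>2))) \<longlonglongrightarrow> level_mean M s"
    and "(\<Sum>x\<in>{x\<in>Z. x < real k}. \<mu> x * (s\<^sup>2 / (s\<^sup>2 + x\<^sup>2))) \<le> level_mean M s"
proof -
  have nn: "M y \<ge> 0" for y unfolding M_def by (intro sum_nonneg \<mu>)
  have mono: "mono M" unfolding M_def
    by (intro monoI sum_mono2 fin \<mu>) auto
  have fin': "finite {x\<in>Z. x < r}" for r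
    by (rule finite_subset[OF _ fin[of r]]) auto
  define N where "N k = (\<lambda>y. \<Sum>x\<in>{x\<in>Z. x < real k}. \<mu> x * (if x \<le> y then 1 else 0))" for k
  have N_alt: "N k y = (\<Sum>x\<in>{x\<in>Z. x < real k \<and> x \<le> y}. \<mu> x)" for k y
  proof -
    have "N k y = (\<Sum>x\<in>{x\<in>Z. x < real k}. if x \<le> y then \<mu> x else 0)"
      unfolding N_def by (intro sum.cong) auto
    also have "\<dots> = (\<Sum>x\<in>{x\<in>{x\<in>Z. x < real k}. x \<le> y}. \<mu> x)"
      by (rule sum.inter_filter[OF fin', symmetric])
    also have "{x\<in>{x\<in>Z. x < real k}. x \<le> y} = {x\<in>Z. x < real k \<and> x \<le> y}" by auto
    finally show ?thesis .
  qed
  have N_le: "N k y \<le> M y" for k y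
    unfolding N_alt M_def by (intro sum_mono2 fin \<mu>) auto
  have N_nn: "N k y \<ge> 0" for k y unfolding N_alt by (intro sum_nonneg \<mu>)
  have N_mono: "mono (N k)" for k unfolding N_alt
    by (intro monoI sum_mono2 finite_subset[OF _ fin'[of k]] \<mu>) auto
  have N_lim: "(\<lambda>k. N k y) \<longlonglongrightarrow> M y" for y
  proof (rule tendsto_eventually)
    obtain k0 where k0: "real k0 > y" using reals_Archimedean2 by blast
    show "eventually (\<lambda>k. N k y = M y) sequentially"
      using eventually_ge_at_top[of k0]
    proof eventually_elim
      case (elim k)
      then have "{x\<in>Z. x < real k \<and> x \<le> y} = {x\<in>Z. x \<le> y}" using k0 by auto
      then show ?case unfolding N_alt M_def by simp
    qed
  qed
  have N_mean: "level_mean (N k) s = (\<Sum>x\<in>{x\<in>Z. x < real k}. \<mu> x * (s\<^sup>2 / (s\<^sup>2 + x\<^sup>2)))" for k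
    unfolding N_def by (rule level_mean_finite_sum) (use fin' Z s in auto)
  have int: "set_integrable lborel {0<..<1} (\<lambda>t. M (s * sqrt (1 / t - 1)))"
    by (rule level_integrand_integrable[OF mono nn rv \<alpha> s])
  have intN: "set_integrable lborel {0<..<1} (\<lambda>t. N k (s * sqrt (1 / t - 1)))" for k
  proof (rule set_integrable_bound[OF int])
    show "set_borel_measurable lborel {0<..<1} (\<lambda>t. N k (s * sqrt (1 / t - 1)))"
      unfolding set_borel_measurable_def using level_integrand_measurable[OF N_mono]
      by (intro borel_measurable_scaleR borel_measurable_indicator) auto
  qed (use N_le N_nn nn in auto)
  show "(\<Sum>x\<in>{x\<in>Z. x < real k}. \<mu> x * (s\<^sup>2 / (s\<^sup>2 + x\<^sup>2))) \<le> level_mean M s"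
    unfolding N_mean[symmetric] level_mean_def
    by (intro set_integral_mono int intN N_le)
  have "(\<lambda>k. level_mean (N k) s) \<longlonglongrightarrow> level_mean M s"
    unfolding level_mean_def set_lebesgue_integral_def
  proof (rule integral_dominated_convergence)
    show "integrable lborel (\<lambda>t. indicator {0<..<1} t *\<^sub>R M (s * sqrt (1 / t - 1)))"
      using int by (simp add: set_integrable_def)
    then show "(\<lambda>t. indicator {0<..<1} t *\<^sub>R M (s * sqrt (1 / t - 1))) \<in> borel_measurable lborel"
      by auto
    show "(\<lambda>t. indicator {0<..<1} t *\<^sub>R N k (s * sqrt (1 / t - 1))) \<in> borel_measurable lborel" for k
      using intN[of k] by (auto simp: set_integrable_def)
    show "AE t in lborel. (\<lambda>k. indicator {0<..<1} t *\<^sub>R N k (s * sqrt (1 / t - 1)))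
            \<longlonglongrightarrow> indicator {0<..<1} t *\<^sub>R M (s * sqrt (1 / t - 1))"
      by (intro AE_I2 tendsto_scaleR tendsto_const N_lim)
    show "AE t in lborel. norm (indicator {0<..<1} t *\<^sub>R N k (s * sqrt (1 / t - 1)))
            \<le> indicator {0<..<1} t *\<^sub>R M (s * sqrt (1 / t - 1))" for k
      using N_le N_nn by (intro AE_I2) (auto simp: indicator_def)
  qed
  then show "(\<lambda>k. \<Sum>x\<in>{x\<in>Z. x < real k}. \<mu> x * (s\<^sup>2 / (s\<^sup>2 + x\<^sup>2))) \<longlonglongrightarrow> level_mean M s"
    unfolding N_mean .
qed

section \<open>Growth bounds for holomorphic functions\<close>

text \<open>
  Where the maximum modulus exceeds 1, the bound on the iterated logarithm can be
  exponentiated twice; elsewhere the conclusion is trivial.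
\<close>
lemma entire_order_growth:
  assumes f: "f holomorphic_on UNIV" and ord: "entire_order f < 2"
  shows "\<exists>\<sigma><2. \<exists>R0. \<forall>z. norm z \<ge> R0 \<longrightarrow> norm (f z) \<le> exp (norm z powr \<sigma>)"
proof -
  obtain c where c: "entire_order f < c" "c < 2" using dense[OF ord] by blast
  define \<sigma> where "\<sigma> = real_of_ereal (max c 0)"
  have \<sigma>: "\<sigma> < 2" "c \<le> ereal \<sigma>" using c unfolding \<sigma>_def
    by (cases c; auto simp: max_def)+
  have "eventually (\<lambda>r. ereal (ln (ln (max_modulus f r)) / ln r) < c) at_top"
    using c(1) unfolding entire_order_def by (rule Limsup_lessD)
  then have "eventually (\<lambda>r. ln (ln (max_modulus f r)) / ln r < \<sigma> \<and> r > 1) at_top"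
    using eventually_gt_at_top[of 1]
  proof eventually_elim
    case (elim r)
    then have "ereal (ln (ln (max_modulus f r)) / ln r) < ereal \<sigma>"
      using \<sigma>(2) by (rule_tac less_le_trans) auto
    with elim show ?case by simp
  qed
  then obtain R0 where R0: "\<And>r. r \<ge> R0 \<Longrightarrow> ln (ln (max_modulus f r)) / ln r < \<sigma> \<and> r > 1"
    unfolding eventually_at_top_linorder by blast
  have "norm (f z) \<le> exp (norm z powr \<sigma>)" if z: "norm z \<ge> R0" for z
  proof -
    define r where "r = norm z"
    define m where "m = max_modulus f r"
    have r: "ln (ln m) / ln r < \<sigma>" "r > 1" using R0[of r] z by (auto simp: r_def m_def)
    have "compact ((\<lambda>z. norm (f z)) ` sphere 0 r)"
      by (intro compact_continuous_image continuous_intros holomorphic_on_imp_continuous_on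
            holomorphic_on_subset[OF f]) auto
    then have "bdd_above ((\<lambda>z. norm (f z)) ` sphere 0 r)"
      by (intro bounded_imp_bdd_above compact_imp_bounded)
    then have fm: "norm (f z) \<le> m" unfolding m_def max_modulus_def
      by (rule cSUP_upper2) (auto simp: r_def)
    show ?thesis
    proof (cases "m \<le> 1")
      case True
      have "norm (f z) \<le> exp 0" using fm True by simp
      also have "\<dots> \<le> exp (norm z powr \<sigma>)" by (subst exp_le_cancel_iff) simp
      finally show ?thesis .
    next
      case False
      then have lm: "ln m > 0" by simp
      have "ln (ln m) < \<sigma> * ln r" using r by (simp add: field_simps)
      then have "ln m < exp (\<sigma> * ln r)"
        using lm by (metis exp_less_cancel_iff exp_ln)
      also have "\<dots> = r powr \<sigma>" using r by (simp add: powr_def)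
      finally have "m < exp (r powr \<sigma>)" using False
        by (metis exp_less_cancel_iff exp_ln not_less_iff_gr_or_eq order_less_le_trans zero_less_one linorder_not_le)
      then show ?thesis using fm by (simp add: r_def)
    qed
  qed
  with \<sigma> show ?thesis by blast
qed

text \<open>
  The fractional linear map \<open>v \<mapsto> v / (2 * A - v)\<close> sends the half-plane \<open>Re v \<le> A\<close> into the
  closed unit disc and fixes 0, so the Schwarz lemma applies to its composition with \<open>L\<close>.
\<close>
lemma borel_caratheodory:
  assumes L: "L holomorphic_on ball a \<rho>" and La: "L a = 0"
    and A: "A > 0" "\<And>z. z \<in> ball a \<rho> \<Longrightarrow> Re (L z) \<le> A"
    and r: "0 \<le> r" "r < \<rho>" and z: "norm (z - a) \<le> r"
  shows "norm (L z) \<le> 2 * A * r / (\<rho> - r)"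
proof -
  define g where "g w = L (a + of_real \<rho> * w)" for w
  have \<rho>: "\<rho> > 0" using r by simp
  have inb: "a + of_real \<rho> * w \<in> ball a \<rho>" if "norm w < 1" for w
    using that \<rho> by (simp add: dist_norm norm_mult)
  have gh: "g holomorphic_on ball 0 1" unfolding g_def
    by (rule holomorphic_on_compose_gen[OF _ L, unfolded o_def])
      (use inb in \<open>auto intro!: holomorphic_intros\<close>)
  have gRe: "Re (g w) \<le> A" if "norm w < 1" for w
    unfolding g_def by (rule A(2)) (rule inb[OF that])
  have den: "2 * of_real A - g w \<noteq> 0" if "norm w < 1" for w
  proof
    assume "2 * of_real A - g w = 0"
    then have "Re (2 * of_real A - g w) = 0" by simp
    then show False using gRe[OF that] A(1) by simp
  qed
  define \<phi> where "\<phi> w = g w / (2 * of_real A - g w)" for w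
  have \<phi>h: "\<phi> holomorphic_on ball 0 1" unfolding \<phi>_def
    by (intro holomorphic_intros gh) (use den in auto)
  have \<phi>0: "\<phi> 0 = 0" by (simp add: \<phi>_def g_def La)
  have \<phi>1: "norm (\<phi> w) \<le> 1" if "norm w < 1" for w
  proof -
    have "(norm (g w))\<^sup>2 \<le> (norm (2 * of_real A - g w))\<^sup>2"
    proof -
      have "0 \<le> A * (A - Re (g w))" using gRe[OF that] A(1) by simp
      then show ?thesis unfolding cmod_power2 by (simp add: power2_eq_square algebra_simps)
    qed
    then have "norm (g w) \<le> norm (2 * of_real A - g w)"
      by (rule power2_le_imp_le) simp
    then show ?thesis using den[OF that] by (simp add: \<phi>_def norm_divide)
  qed
  \<comment> \<open>The Schwarz lemma asks for values in the open disc, so it is applied to \<open>t * \<phi>\<close> with \<open>t < 1\<close>, and then \<open>t\<close> tends to 1.\<close>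
  have \<phi>le: "norm (\<phi> w) \<le> norm w" if w: "norm w < 1" for w
  proof -
    have "norm (of_real t * \<phi> w) \<le> norm w" if t: "0 < t" "t < 1" for t :: real
    proof (rule Schwarz_Lemma(1)[of "\<lambda>w. of_real t * \<phi> w"])
      show "(\<lambda>w. of_real t * \<phi> w) holomorphic_on ball 0 1" by (intro holomorphic_intros \<phi>h)
      show "norm (of_real t * \<phi> z) < 1" if "norm z < 1" for z
      proof -
        have "norm (of_real t * \<phi> z) = t * norm (\<phi> z)" using t by (simp add: norm_mult)
        also have "\<dots> \<le> t" using \<phi>1[OF that] t by (simp add: mult_left_le)
        finally show ?thesis using t by linarith
      qed
    qed (use \<phi>0 w in auto)
    then have *: "t * norm (\<phi> w) \<le> norm w" if "0 < t" "t < 1" for t :: real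
      using that by (simp add: norm_mult)
    have "((\<lambda>t. t * norm (\<phi> w)) \<longlongrightarrow> 1 * norm (\<phi> w)) (at_left 1)"
      by (intro tendsto_intros)
    then have "1 * norm (\<phi> w) \<le> norm w"
    proof (rule tendsto_upperbound)
      have "eventually (\<lambda>t::real. t \<in> {0<..<1}) (at_left 1)"
        by (rule eventually_at_leftI[of 0]) auto
      then show "eventually (\<lambda>t. t * norm (\<phi> w) \<le> norm w) (at_left 1)"
        by eventually_elim (use * in auto)
    qed simp
    then show ?thesis by simp
  qed
  define w where "w = (z - a) / of_real \<rho>"
  have w: "norm w \<le> r / \<rho>" "norm w < 1"
  proof -
    show *: "norm w \<le> r / \<rho>" using z \<rho> by (simp add: w_def norm_divide divide_right_mono)
    have "r / \<rho> < 1" using r \<rho> by simp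
    with * show "norm w < 1" by linarith
  qed
  have Lz: "L z = g w" using \<rho> by (simp add: g_def w_def)
  have "g w = \<phi> w * (2 * of_real A - g w)" using den[OF w(2)] by (simp add: \<phi>_def)
  then have "norm (g w) = norm (\<phi> w) * norm (2 * of_real A - g w)" by (metis norm_mult)
  also have "\<dots> \<le> norm (\<phi> w) * (2 * A + norm (g w))"
    using norm_triangle_ineq4[of "2 * of_real A" "g w"] A(1) by (intro mult_left_mono) auto
  also have "\<dots> \<le> (r / \<rho>) * (2 * A + norm (g w))"
    using \<phi>le[OF w(2)] w(1) A(1) by (intro mult_right_mono) auto
  finally have "norm (g w) \<le> (r / \<rho>) * (2 * A + norm (g w))" .
  then have "norm (g w) * (\<rho> - r) \<le> 2 * A * r" using \<rho> by (simp add: field_simps)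
  then show ?thesis unfolding Lz using r by (simp add: pos_le_divide_eq)
qed

text \<open>
  The Borel--Caratheodory inequality bounds \<open>L\<close> by a multiple of \<open>A\<close>, and Cauchy's
  inequality then bounds the second derivative by a multiple of \<open>A / R\<^sup>2\<close>. Since the first
  derivative vanishes at 0, integrating twice keeps the factor \<open>1 / R\<^sup>2\<close>. With only \<open>1 / R\<close>,
  functions of order between 1 and 2 would be out of reach. The base point \<open>\<i>\<close> is where the
  products over the roots are normalised; it is never a root.
\<close>
lemma holomorphic_critical_bound:
  assumes L: "L holomorphic_on ball 0 R" and Li: "L \<i> = 0" and dL: "deriv L 0 = 0"
    and A: "A > 0" "\<And>z. z \<in> ball 0 R \<Longrightarrow> Re (L z) \<le> A"
    and \<rho>: "\<rho> \<ge> 1" "8 * \<rho> \<le> R" and z: "norm z \<le> \<rho>"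
  shows "norm (L z) \<le> 512 * A * \<rho>\<^sup>2 / R\<^sup>2"
proof -
  have R: "R \<ge> 8" using \<rho> by simp
  have Lb: "norm (L w) \<le> 2 * A" if w: "norm w \<le> R / 4" for w
  proof -
    have sub: "ball \<i> (R - 1) \<subseteq> ball 0 R"
      by (simp add: ball_subset_ball_iff)
    have "norm (L w) \<le> 2 * A * ((R - 1) / 2) / ((R - 1) - (R - 1) / 2)"
    proof (rule borel_caratheodory[OF holomorphic_on_subset[OF L sub] Li A(1)])
      show "Re (L x) \<le> A" if "x \<in> ball \<i> (R - 1)" for x using A(2) sub that by blast
      have "norm (w - \<i>) \<le> norm w + 1" using norm_triangle_ineq4[of w \<i>] by simp
      then show "norm (w - \<i>) \<le> (R - 1) / 2" using w R by simp
    qed (use R in auto)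
    also have "\<dots> = 2 * A" using R by (simp add: field_simps)
    finally show ?thesis .
  qed
  have L2: "norm ((deriv ^^ 2) L w) \<le> 256 * A / R\<^sup>2" if w: "norm w \<le> R / 8" for w
  proof -
    have sub: "cball w (R / 8) \<subseteq> ball 0 R"
    proof
      fix x assume "x \<in> cball w (R / 8)"
      then show "x \<in> ball 0 R"
        using norm_triangle_ineq[of w "x - w"] w R by (simp add: dist_norm norm_minus_commute)
    qed
    have "norm ((deriv ^^ 2) L w) \<le> fact 2 * (2 * A) / (R / 8) ^ 2"
    proof (rule Cauchy_inequality)
      show "L holomorphic_on ball w (R / 8)"
        by (rule holomorphic_on_subset[OF L]) (use sub in auto)
      show "continuous_on (cball w (R / 8)) L"
        by (rule holomorphic_on_imp_continuous_on[OF holomorphic_on_subset[OF L sub]])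
      show "norm (L x) \<le> 2 * A" if "norm (w - x) = R / 8" for x
        by (rule Lb) (use norm_triangle_ineq[of w "x - w"] w that in \<open>simp add: norm_minus_commute\<close>)
    qed (use R in auto)
    also have "\<dots> = 256 * A / R\<^sup>2" by (simp add: field_simps power2_eq_square)
    finally show ?thesis .
  qed
  have sub\<rho>: "w \<in> ball 0 R" "norm w \<le> R / 8" if "w \<in> cball 0 \<rho>" for w using that \<rho> by auto
  have L1: "norm (deriv L w) \<le> 256 * A / R\<^sup>2 * \<rho>" if w: "w \<in> cball 0 \<rho>" for w
  proof -
    have "norm (deriv L w - deriv L 0) \<le> 256 * A / R\<^sup>2 * norm (w - 0)"
    proof (rule field_differentiable_bound[where S = "cball 0 \<rho>" and f' = "(deriv ^^ 2) L"])
      show "(deriv L has_field_derivative (deriv ^^ 2) L x) (at x within cball 0 \<rho>)"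
        if "x \<in> cball 0 \<rho>" for x
      proof -
        have "deriv L holomorphic_on ball 0 R" by (intro holomorphic_deriv L) auto
        from holomorphic_derivI[OF this _ sub\<rho>(1)[OF that]]
        show ?thesis by (simp add: numeral_2_eq_2 has_field_derivative_at_within)
      qed
      show "norm ((deriv ^^ 2) L x) \<le> 256 * A / R\<^sup>2" if "x \<in> cball 0 \<rho>" for x
        by (rule L2) (rule sub\<rho>(2)[OF that])
    qed (use w \<rho> in auto)
    also have "\<dots> \<le> 256 * A / R\<^sup>2 * \<rho>" using w A(1) by (intro mult_left_mono) auto
    finally show ?thesis using dL by simp
  qed
  have "norm (L z - L \<i>) \<le> 256 * A / R\<^sup>2 * \<rho> * norm (z - \<i>)"
  proof (rule field_differentiable_bound[where S = "cball 0 \<rho>" and f' = "deriv L"])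
    show "(L has_field_derivative deriv L x) (at x within cball 0 \<rho>)" if "x \<in> cball 0 \<rho>" for x
      using holomorphic_derivI[OF L _ sub\<rho>(1)[OF that]] by (simp add: has_field_derivative_at_within)
  qed (use L1 z \<rho> in auto)
  also have "\<dots> \<le> 256 * A / R\<^sup>2 * \<rho> * (2 * \<rho>)"
    using norm_triangle_ineq4[of z \<i>] z \<rho> A(1) by (intro mult_left_mono) auto
  also have "\<dots> = 512 * A * \<rho>\<^sup>2 / R\<^sup>2" by (simp add: power2_eq_square)
  finally show ?thesis using Li by simp
qed

section \<open>Dividing an even entire function by its small roots\<close>

text \<open>
  The pair of roots \<open>x\<close> and \<open>-x\<close> contributes one factor, normalised to be 1 at \<open>\<i>\<close>. For \<open>x = 0\<close>
  the factor is \<open>- z\<^sup>2\<close>, so that \<open>m 0\<close> is half the order of the root at the origin.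
\<close>
definition paired_prod :: "(real \<Rightarrow> nat) \<Rightarrow> real set \<Rightarrow> complex \<Rightarrow> complex" where
  "paired_prod m S z = (\<Prod>x\<in>S. ((of_real (x\<^sup>2) - z\<^sup>2) / of_real (1 + x\<^sup>2)) ^ m x)"

lemma one_plus_square_neq_0: "complex_of_real (1 + x\<^sup>2) \<noteq> 0"
proof -
  have "1 + x\<^sup>2 > 0" by (simp add: add_pos_nonneg)
  then show ?thesis by (metis less_irrefl of_real_eq_0_iff)
qed

lemma paired_prod_holomorphic [holomorphic_intros]: "paired_prod m S holomorphic_on A"
  unfolding paired_prod_def by (intro holomorphic_intros one_plus_square_neq_0)

lemma paired_prod_i: "paired_prod m S \<i> = 1"
proof -
  have "paired_prod m S \<i> = (\<Prod>x\<in>S. 1)"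
    unfolding paired_prod_def
    by (intro prod.cong refl) (use one_plus_square_neq_0 in \<open>simp add: add.commute\<close>)
  then show ?thesis by simp
qed

lemma paired_prod_eq_0_iff:
  assumes "finite S" "\<And>x. x \<in> S \<Longrightarrow> m x > 0"
  shows "paired_prod m S z = 0 \<longleftrightarrow> (\<exists>x\<in>S. z = of_real x \<or> z = - of_real x)"
proof -
  have "of_real (x\<^sup>2) - z\<^sup>2 = 0 \<longleftrightarrow> z = of_real x \<or> z = - of_real x" for x
    using power2_eq_iff[of z "of_real x"] by auto
  then show ?thesis
    unfolding paired_prod_def using assms one_plus_square_neq_0 by (auto simp: prod_zero_iff)
qed

lemma zorder_paired_prod:
  assumes S: "finite S" "\<And>x. x \<in> S \<Longrightarrow> x \<ge> 0" and a: "\<bar>a\<bar> \<in> S"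
  shows "zorder (paired_prod m S) (of_real a) = (if a = 0 then 2 * int (m 0) else int (m \<bar>a\<bar>))"
proof -
  define rest where "rest = paired_prod m (S - {\<bar>a\<bar>})"
  have rest0: "rest (of_real a) \<noteq> 0"
  proof -
    have "complex_of_real (x\<^sup>2) - (of_real a)\<^sup>2 \<noteq> 0" if "x \<in> S - {\<bar>a\<bar>}" for x
    proof -
      have "x\<^sup>2 \<noteq> a\<^sup>2" using that S(2)[of x] by (auto simp: power2_eq_iff)
      then show ?thesis by (metis of_real_eq_iff of_real_power right_minus_eq)
    qed
    then show ?thesis unfolding rest_def paired_prod_def
      using S(1) one_plus_square_neq_0 by (auto simp: prod_zero_iff)
  qed
  have split: "paired_prod m S z = ((of_real (a\<^sup>2) - z\<^sup>2) / of_real (1 + a\<^sup>2)) ^ m \<bar>a\<bar> * rest z" for z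
  proof -
    have "of_real (\<bar>a\<bar>\<^sup>2) = complex_of_real (a\<^sup>2)" "1 + \<bar>a\<bar>\<^sup>2 = 1 + a\<^sup>2" by simp_all
    then show ?thesis
      unfolding paired_prod_def rest_def prod.remove[OF S(1) a] by metis
  qed
  show ?thesis
  proof (cases "a = 0")
    case True
    have "zorder (paired_prod m S) (of_real a) = int (2 * m 0)"
    proof (rule zorder_eqI[where S = UNIV and g = "\<lambda>z. (-1) ^ m 0 * rest z"])
      show "(\<lambda>z. (-1) ^ m 0 * rest z) holomorphic_on UNIV" unfolding rest_def by (intro holomorphic_intros)
      fix w :: complex
      have "paired_prod m S w = (- (w\<^sup>2)) ^ m 0 * rest w" using split[of w] True by simp
      also have "(- (w\<^sup>2)) ^ m 0 = (-1) ^ m 0 * w ^ (2 * m 0)"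
        by (subst power_minus) (simp add: power_mult)
      finally show "paired_prod m S w = (-1) ^ m 0 * rest w * (w - of_real a) powi int (2 * m 0)"
        using True by (simp only: of_real_0 diff_zero power_int_of_nat mult_ac)
    qed (use rest0 in auto)
    then show ?thesis using True by simp
  next
    case False
    let ?c = "\<lambda>z::complex. (- (z + of_real a) / of_real (1 + a\<^sup>2)) ^ m \<bar>a\<bar>"
    have "zorder (paired_prod m S) (of_real a) = int (m \<bar>a\<bar>)"
    proof (rule zorder_eqI[where S = UNIV and g = "\<lambda>z. ?c z * rest z"])
      show "(\<lambda>z. ?c z * rest z) holomorphic_on UNIV" unfolding rest_def
        by (intro holomorphic_intros one_plus_square_neq_0)
      have "complex_of_real a + of_real a \<noteq> 0" using False by (simp add: of_real_add[symmetric] del: of_real_add)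
      then show "?c (of_real a) * rest (of_real a) \<noteq> 0" using rest0 one_plus_square_neq_0[of a]
        by simp
      fix w :: complex
      have "(of_real (a\<^sup>2) - w\<^sup>2) / of_real (1 + a\<^sup>2) = - (w + of_real a) / of_real (1 + a\<^sup>2) * (w - of_real a)"
        by (simp add: power2_eq_square algebra_simps diff_divide_distrib)
      then show "paired_prod m S w = ?c w * rest w * (w - of_real a) powi int (m \<bar>a\<bar>)"
        unfolding split by (simp only: power_mult_distrib power_int_of_nat mult_ac)
    qed auto
    then show ?thesis using False by simp
  qed
qed

definition nonneg_zeros :: "(complex \<Rightarrow> complex) \<Rightarrow> real set" where
  "nonneg_zeros f = {x. x \<ge> 0 \<and> f (of_real x) = 0}"

definition pair_mult :: "(complex \<Rightarrow> complex) \<Rightarrow> real \<Rightarrow> nat" where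
  "pair_mult f x = (if x = 0 then nat (zorder f 0) div 2 else nat (zorder f (of_real x)))"

lemma entire_zorder_facts:
  assumes f: "f holomorphic_on UNIV" and nz: "f w \<noteq> 0"
  shows "zorder f z \<ge> 0" "f z = 0 \<Longrightarrow> zorder f z > 0"
    and "\<exists>r>0. \<exists>g. g holomorphic_on cball z r \<and> (\<forall>w\<in>cball z r. f w = g w * (w - z) ^ nat (zorder f z) \<and> g w \<noteq> 0)"
proof -
  have *: "(if f z = 0 then 0 < zorder f z else zorder f z = 0) \<and>
      (\<exists>r>0. cball z r \<subseteq> UNIV \<and> zor_poly f z holomorphic_on cball z r \<and>
        (\<forall>w\<in>cball z r. f w = zor_poly f z w * (w - z) ^ nat (zorder f z) \<and> zor_poly f z w \<noteq> 0))"
    by (rule zorder_exist_zero[OF f]) (use nz in auto)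
  then show "zorder f z \<ge> 0" "f z = 0 \<Longrightarrow> zorder f z > 0" by (auto split: if_splits)
  from * show "\<exists>r>0. \<exists>g. g holomorphic_on cball z r \<and>
      (\<forall>w\<in>cball z r. f w = g w * (w - z) ^ nat (zorder f z) \<and> g w \<noteq> 0)" by blast
qed

lemma even_zorder_uminus:
  assumes f: "f holomorphic_on UNIV" and ev: "\<And>z. f (- z) = f z" and nz: "f w \<noteq> 0"
  shows "zorder f (- z) = zorder f z"
proof -
  obtain r g where r: "r > 0" and g: "g holomorphic_on cball z r"
    "\<And>w. w \<in> cball z r \<Longrightarrow> f w = g w * (w - z) ^ nat (zorder f z) \<and> g w \<noteq> 0"
    using entire_zorder_facts(3)[OF f nz, of z] by blast
  define n where "n = nat (zorder f z)"
  have n: "zorder f z = int n" using entire_zorder_facts(1)[OF f nz, of z] by (simp add: n_def)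
  have inb: "- w \<in> cball z r" if "w \<in> ball (- z) r" for w
    using that dist_minus[of "-w" z] by (simp add: dist_commute)
  have "zorder f (- z) = int n"
  proof (rule zorder_eqI[where S = "ball (- z) r" and g = "\<lambda>w. (-1) ^ n * g (- w)"])
    show "(\<lambda>w. (-1) ^ n * g (- w)) holomorphic_on ball (- z) r"
      by (intro holomorphic_intros holomorphic_on_compose_gen[OF _ g(1), unfolded o_def])
        (use inb in auto)
    show "(-1) ^ n * g (- (- z)) \<noteq> 0" using g(2)[of z] r by simp
    fix w assume w: "w \<in> ball (- z) r"
    have "f w = g (- w) * (- w - z) ^ n" using g(2)[OF inb[OF w]] ev[of w] by (simp add: n_def)
    also have "- w - z = - (w - (- z))" by simp
    also have "(- (w - (- z))) ^ n = (-1) ^ n * (w - (- z)) ^ n" by (rule power_minus)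
    finally show "f w = (-1) ^ n * g (- w) * (w - (- z)) powi int n"
      by (simp only: power_int_of_nat mult_ac)
  qed (use r in auto)
  then show ?thesis using n by simp
qed

text \<open>
  Write \<open>f w = g w * w ^ k\<close> with \<open>g 0 \<noteq> 0\<close>. For odd \<open>k\<close>, evenness of \<open>f\<close> would give
  \<open>g (- w) = - g w\<close> near 0, hence \<open>g 0 = 0\<close>.
\<close>
lemma even_zorder_0:
  assumes f: "f holomorphic_on UNIV" and ev: "\<And>z. f (- z) = f z" and nz: "f w \<noteq> 0"
  shows "even (nat (zorder f 0))"
proof (rule ccontr)
  assume odd: "odd (nat (zorder f 0))"
  obtain r g where r: "r > 0" and g: "g holomorphic_on cball 0 r"
    "\<And>w. w \<in> cball 0 r \<Longrightarrow> f w = g w * w ^ nat (zorder f 0) \<and> g w \<noteq> 0"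
    using entire_zorder_facts(3)[OF f nz, of 0] by auto
  have contg: "continuous_on (ball 0 r) g"
    by (rule continuous_on_subset[OF holomorphic_on_imp_continuous_on[OF g(1)]]) auto
  have cg: "(g \<longlongrightarrow> g 0) (at 0)"
    using contg r continuous_on_eq_continuous_at[of "ball 0 r" g] by (auto simp: isCont_def)
  have "filterlim uminus (at (0::complex)) (at 0)"
    by (auto simp: filterlim_at eventually_at_filter intro!: tendsto_eq_intros)
  then have cg': "((\<lambda>w. g (- w)) \<longlongrightarrow> g 0) (at 0)"
    by (rule filterlim_compose[OF cg])
  have "eventually (\<lambda>w. w \<in> ball 0 r \<and> w \<noteq> 0) (at (0::complex))"
    using eventually_at_in_open[of "ball 0 r" "0::complex"] r by (auto elim: eventually_mono)
  then have "eventually (\<lambda>w. g w + g (- w) = 0) (at 0)"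
  proof eventually_elim
    case (elim w)
    have "g w * w ^ nat (zorder f 0) = g (- w) * (- w) ^ nat (zorder f 0)"
      using g(2)[of w] g(2)[of "- w"] ev[of w] elim by auto
    also have "(- w) ^ nat (zorder f 0) = - (w ^ nat (zorder f 0))" using odd by simp
    finally have "(g w + g (- w)) * w ^ nat (zorder f 0) = 0" by (simp add: algebra_simps)
    then show ?case using elim by simp
  qed
  then have "((\<lambda>w. g w + g (- w)) \<longlongrightarrow> 0) (at 0)" by (rule tendsto_eventually)
  moreover have "((\<lambda>w. g w + g (- w)) \<longlongrightarrow> g 0 + g 0) (at 0)" by (intro tendsto_add cg cg')
  ultimately have "g 0 + g 0 = 0" by (rule LIM_unique[symmetric])
  then show False using g(2)[of 0] r by simp
qed

lemma finite_nonneg_zeros: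
  assumes f: "f holomorphic_on UNIV" and nz: "f w \<noteq> 0"
  shows "finite {x\<in>nonneg_zeros f. x \<le> R}"
proof -
  have "finite {z\<in>cball 0 R. f z = 0}"
  proof (cases "f constant_on UNIV")
    case True
    then show ?thesis using nz by (auto simp: constant_on_def)
  next
    case False
    show ?thesis by (rule holomorphic_compact_finite_zeros[OF f]) (use False in auto)
  qed
  then have "finite (complex_of_real ` {x\<in>nonneg_zeros f. x \<le> R})"
    by (rule finite_subset[rotated]) (auto simp: nonneg_zeros_def)
  then show ?thesis by (rule finite_imageD) (auto simp: inj_on_def)
qed

lemma pair_mult_pos:
  assumes f: "f holomorphic_on UNIV" and ev: "\<And>z. f (- z) = f z" and nz: "f w \<noteq> 0"
    and x: "x \<in> nonneg_zeros f"
  shows "pair_mult f x > 0"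
proof (cases "x = 0")
  case True
  have "zorder f 0 > 0" using entire_zorder_facts(2)[OF f nz, of 0] x True by (simp add: nonneg_zeros_def)
  then have "nat (zorder f 0) \<ge> 2" using even_zorder_0[OF f ev nz] by (elim evenE) auto
  then show ?thesis using True by (simp add: pair_mult_def)
next
  case False
  then show ?thesis
    using entire_zorder_facts(2)[OF f nz, of "of_real x"] x by (simp add: pair_mult_def nonneg_zeros_def)
qed

definition truncated_prod :: "(complex \<Rightarrow> complex) \<Rightarrow> real \<Rightarrow> complex \<Rightarrow> complex" where
  "truncated_prod f R = paired_prod (pair_mult f) {x\<in>nonneg_zeros f. x < R}"

text \<open>
  Inside the disc the quotient is the holomorphic function without zeros that exists because
  both functions have the same zeros with the same orders there; outside it is the plain
  quotient \<open>f z / W z\<close>. The two definitions agree where both make sense.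
\<close>
lemma truncated_prod_factor:
  assumes f: "f holomorphic_on UNIV" and ev: "\<And>z. f (- z) = f z" and nz: "f w \<noteq> 0"
    and rr: "\<And>z. f z = 0 \<Longrightarrow> z \<in> \<real>"
  obtains F where "F holomorphic_on UNIV" "\<And>z. norm z < R \<Longrightarrow> F z \<noteq> 0"
    "\<And>z. f z = F z * truncated_prod f R z"
proof -
  define S where "S = {x\<in>nonneg_zeros f. x < R}"
  define m where "m = pair_mult f"
  define W where "W = truncated_prod f R"
  have Wp: "W = paired_prod m S" by (simp add: W_def m_def S_def truncated_prod_def)
  have finS: "finite S" unfolding S_def
    by (rule finite_subset[OF _ finite_nonneg_zeros[OF f nz, of R]]) auto
  have Spos: "x \<ge> 0" if "x \<in> S" for x using that by (auto simp: S_def nonneg_zeros_def)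
  have mpos: "m x > 0" if "x \<in> S" for x
    unfolding m_def by (rule pair_mult_pos[OF f ev nz]) (use that in \<open>auto simp: S_def\<close>)
  have W0: "W z = 0 \<longleftrightarrow> (\<exists>x\<in>S. z = of_real x \<or> z = - of_real x)" for z
    unfolding Wp by (rule paired_prod_eq_0_iff[OF finS mpos])
  have Wf: "f z = 0" if "W z = 0" for z
    using that ev unfolding W0 by (auto simp: S_def nonneg_zeros_def)
  have Wiff: "W z = 0 \<longleftrightarrow> f z = 0" if z: "z \<in> ball 0 R" for z
  proof
    assume f0: "f z = 0"
    then obtain a where a: "z = of_real a" using rr by (metis Reals_cases)
    have "f (of_real \<bar>a\<bar>) = 0" using f0 a ev[of z] by (simp add: abs_if)
    then have "\<bar>a\<bar> \<in> S" using z a by (simp add: S_def nonneg_zeros_def)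
    then show "W z = 0" unfolding W0 a
      by (intro bexI[of _ "\<bar>a\<bar>"]) (auto simp: abs_if)
  qed (rule Wf)
  have zo: "zorder W z = zorder f z" if z: "z \<in> ball 0 R" for z
  proof (cases "f z = 0")
    case True
    then obtain x where x: "x \<in> S" "z = of_real x \<or> z = - of_real x" using Wiff[OF z] W0 by blast
    then obtain a where a: "z = of_real a" "\<bar>a\<bar> = x" using Spos[OF x(1)]
      by (metis abs_minus abs_of_nonneg of_real_minus)
    have *: "zorder W z = (if a = 0 then 2 * int (m 0) else int (m \<bar>a\<bar>))"
      unfolding Wp a(1) by (rule zorder_paired_prod[OF finS Spos]) (use a x in auto)
    show ?thesis
    proof (cases "a = 0")
      case True
      have "2 * int (m 0) = int (2 * (nat (zorder f 0) div 2))" by (simp add: m_def pair_mult_def)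
      also have "2 * (nat (zorder f 0) div 2) = nat (zorder f 0)"
        using even_zorder_0[OF f ev nz] by simp
      also have "int (nat (zorder f 0)) = zorder f 0" using entire_zorder_facts(1)[OF f nz] by simp
      finally show ?thesis using * True a by simp
    next
      case False
      have "zorder f (of_real \<bar>a\<bar>) = zorder f z"
        using even_zorder_uminus[OF f ev nz, of z] a by (auto simp: abs_if)
      then show ?thesis using * False entire_zorder_facts(1)[OF f nz, of z]
        by (simp add: m_def pair_mult_def)
    qed
  next
    case False
    then have "W z \<noteq> 0" using Wiff[OF z] by simp
    moreover have "W analytic_on {z}" "f analytic_on {z}"
      using f by (auto simp: Wp intro!: holomorphic_on_imp_analytic_at[of _ UNIV] holomorphic_intros)
    ultimately show ?thesis using False by (simp add: zorder_eq_0I)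
  qed
  have Wh: "W holomorphic_on A" for A unfolding Wp by (rule paired_prod_holomorphic)
  obtain h where h: "h holomorphic_on ball 0 R" "\<And>z. z \<in> ball 0 R \<Longrightarrow> h z \<noteq> 0"
    "\<And>z. z \<in> ball 0 R \<Longrightarrow> f z = h z * W z"
  proof (rule holomorphic_zorder_factorization[of f "ball 0 R" W])
    show "f holomorphic_on ball 0 R" by (rule holomorphic_on_subset[OF f]) auto
    show "W holomorphic_on ball 0 R" by (rule Wh)
    show "W z = 0 \<longleftrightarrow> f z = 0" "zorder W z = zorder f z" if "z \<in> ball 0 R" for z
      using Wiff[OF that] zo[OF that] by auto
  qed (use that in auto)
  define F where "F z = (if W z = 0 then h z else f z / W z)" for z
  have Fh: "F z = h z" if "z \<in> ball 0 R" for z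
    using h(3)[OF that] by (auto simp: F_def)
  have W0b: "z \<in> ball 0 R" if "W z = 0" for z
    using that Spos unfolding W0 by (auto simp: S_def)
  have o1: "open {z. W z \<noteq> 0}"
    using holomorphic_on_imp_continuous_on[OF Wh[of UNIV]] by (intro open_Collect_neq) auto
  have "F holomorphic_on (ball 0 R \<union> {z. W z \<noteq> 0})"
  proof (rule holomorphic_on_Un)
    show "F holomorphic_on ball 0 R"
      using h(1) Fh holomorphic_cong by metis
    have "(\<lambda>z. f z / W z) holomorphic_on {z. W z \<noteq> 0}"
      by (intro holomorphic_on_divide Wh holomorphic_on_subset[OF f]) auto
    then show "F holomorphic_on {z. W z \<noteq> 0}"
      by (rule holomorphic_transform) (auto simp: F_def)
  qed (use o1 in auto)
  also have "ball 0 R \<union> {z. W z \<noteq> 0} = UNIV" using W0b by auto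
  finally have "F holomorphic_on UNIV" .
  moreover have "f z = F z * W z" for z using Wf by (auto simp: F_def)
  moreover have "F z \<noteq> 0" if "norm z < R" for z using Fh[of z] h(2)[of z] that by simp
  ultimately show thesis using that by (simp add: W_def)
qed

section \<open>Even entire functions of order less than 2 as limits of products\<close>

text \<open>
  Let \<open>F = f / W\<close> with \<open>W\<close> the product over the roots below \<open>R\<close>. On the circle of radius \<open>2 * R\<close>
  every factor of \<open>W\<close> has modulus at least 1, so the growth bound for \<open>f\<close> carries over to
  \<open>F\<close>, and to the whole disc by the maximum principle. In the disc of radius \<open>R\<close> the
  function \<open>F\<close> has no zeros, hence a logarithm; \<open>F\<close> is even, so the logarithm has a critical
  point at 0 and \<open>holomorphic_critical_bound\<close> applies to it.
\<close>
lemma truncated_prod_approx: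
  assumes f: "f holomorphic_on UNIV" and ev: "\<And>z. f (- z) = f z" and nz: "f w \<noteq> 0"
    and rr: "\<And>z. f z = 0 \<Longrightarrow> z \<in> \<real>"
    and growth: "\<And>z. norm z \<ge> R0 \<Longrightarrow> norm (f z) \<le> exp (norm z powr \<sigma>)"
    and \<rho>: "\<rho> \<ge> 1" "8 * \<rho> \<le> R" and R: "R0 \<le> 2 * R" and z: "norm z \<le> \<rho>"
  shows "\<exists>u. truncated_prod f R z = f z / f \<i> * exp (- u) \<and>
     norm u \<le> 512 * ((2 * R) powr \<sigma> + \<bar>ln (norm (f \<i>))\<bar> + 1) * \<rho>\<^sup>2 / R\<^sup>2"
proof -
  have R8: "R \<ge> 8" using \<rho> by simp
  define W where "W = truncated_prod f R"
  obtain F where F: "F holomorphic_on UNIV" "\<And>z. norm z < R \<Longrightarrow> F z \<noteq> 0" "\<And>z. f z = F z * W z"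
    using truncated_prod_factor[OF f ev nz rr, of R] unfolding W_def by metis
  have Wi: "W \<i> = 1" unfolding W_def truncated_prod_def by (rule paired_prod_i)
  have Wh: "W holomorphic_on A" for A
    unfolding W_def truncated_prod_def by (rule paired_prod_holomorphic)
  have Wev: "W (- z) = W z" for z by (simp add: W_def truncated_prod_def paired_prod_def)
  have fi: "f \<i> \<noteq> 0" using rr[of \<i>] by (auto simp: complex_is_Real_iff)
  have Fi: "F \<i> = f \<i>" using F(3)[of \<i>] Wi by simp
  have Fev: "F (- z) = F z" for z
  proof (rule analytic_continuation_open[where s = "{z. W z \<noteq> 0}" and s' = UNIV and f = "\<lambda>z. F (- z)"])
    show "open {z. W z \<noteq> 0}"
      using holomorphic_on_imp_continuous_on[OF Wh[of UNIV]] by (intro open_Collect_neq) auto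
    show "{z. W z \<noteq> 0} \<noteq> {}" using Wi by (auto intro!: exI[of _ \<i>])
    show "(\<lambda>z. F (- z)) holomorphic_on UNIV"
      by (intro holomorphic_intros holomorphic_on_compose_gen[OF _ F(1), unfolded o_def]) auto
    fix z assume z: "z \<in> {z. W z \<noteq> 0}"
    have "F (- z) * W z = F z * W z"
      using F(3)[of z] F(3)[of "- z"] ev[of z] Wev[of z] by metis
    with z show "F (- z) = F z" by simp
  qed (use F(1) in auto)
  have dF: "deriv F 0 = 0"
  proof -
    have dF0: "(F has_field_derivative deriv F 0) (at 0)"
      by (rule holomorphic_derivI[OF F(1)]) auto
    have "((\<lambda>z. F (- z)) has_field_derivative deriv F 0 * (-1)) (at 0)"
      by (rule DERIV_chain2[where g = uminus]) (use dF0 in \<open>auto intro!: derivative_eq_intros\<close>)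
    then have "(F has_field_derivative - deriv F 0) (at 0)" using Fev by simp
    from DERIV_unique[OF dF0 this] show ?thesis by simp
  qed
  define A where "A = (2 * R) powr \<sigma> + \<bar>ln (norm (f \<i>))\<bar> + 1"
  have A: "A > 0" unfolding A_def using powr_ge_zero[of "2 * R" \<sigma>] by linarith
  have Wbig: "norm (W z) \<ge> 1" if z: "norm z = 2 * R" for z
  proof -
    have "norm ((of_real (x\<^sup>2) - z\<^sup>2) / of_real (1 + x\<^sup>2) :: complex) \<ge> 1"
      if x: "x \<in> {x\<in>nonneg_zeros f. x < R}" for x
    proof -
      have x2: "x\<^sup>2 \<le> R\<^sup>2" using x by (intro power_mono) (auto simp: nonneg_zeros_def)
      have R2: "1 \<le> R\<^sup>2" using R8 by (simp add: one_le_power)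
      have x0: "x\<^sup>2 \<ge> 0" by simp
      have "(2 * R)\<^sup>2 - x\<^sup>2 \<le> norm (z\<^sup>2 - of_real (x\<^sup>2))"
        using norm_triangle_ineq2[of "z\<^sup>2" "of_real (x\<^sup>2)"] z by (simp add: norm_power)
      moreover have "1 + x\<^sup>2 \<le> (2 * R)\<^sup>2 - x\<^sup>2"
        using x2 R2 by (simp add: power_mult_distrib)
      ultimately have "1 + x\<^sup>2 \<le> norm (of_real (x\<^sup>2) - z\<^sup>2)" by (simp add: norm_minus_commute)
      moreover have "norm (complex_of_real (1 + x\<^sup>2)) = 1 + x\<^sup>2" using x0 by (simp del: of_real_add)
      moreover have "1 + x\<^sup>2 > 0" using x0 by linarith
      ultimately show ?thesis unfolding norm_divide by (simp add: pos_le_divide_eq)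
    qed
    then show ?thesis unfolding W_def truncated_prod_def paired_prod_def prod_norm[symmetric] norm_power
      by (intro prod_ge_1 one_le_power) auto
  qed
  have Fbound: "norm (F z) \<le> exp ((2 * R) powr \<sigma>)" if z: "norm z \<le> 2 * R" for z
  proof (rule maximum_modulus_frontier[where S = "cball 0 (2 * R)" and f = F])
    fix y assume "y \<in> frontier (cball (0::complex) (2 * R))"
    then have y: "norm y = 2 * R" using R8 by simp
    have "norm (F y) * 1 \<le> norm (F y) * norm (W y)" using Wbig[OF y] by (intro mult_left_mono) auto
    also have "\<dots> = norm (f y)" by (simp add: F(3) norm_mult)
    also have "\<dots> \<le> exp ((2 * R) powr \<sigma>)" using growth[of y] y R by simp
    finally show "norm (F y) \<le> exp ((2 * R) powr \<sigma>)" by simp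
  qed (use z holomorphic_on_subset[OF F(1)] holomorphic_on_imp_continuous_on[OF holomorphic_on_subset[OF F(1)]] in auto)
  have FRh: "(\<lambda>z. F z / f \<i>) holomorphic_on ball 0 R"
    by (intro holomorphic_intros holomorphic_on_subset[OF F(1)] fi) auto
  obtain g where g: "g holomorphic_on ball 0 R" "\<And>z. z \<in> ball 0 R \<Longrightarrow> F z / f \<i> = exp (g z)"
    by (rule contractible_imp_holomorphic_log[OF FRh]) (use F(2) fi in \<open>auto simp: convex_imp_contractible\<close>)
  define L where "L z = g z - g \<i>" for z
  have iR: "\<i> \<in> ball 0 R" using R8 by simp
  have egi: "exp (g \<i>) = 1" using g(2)[OF iR] Fi fi by simp
  have L: "L holomorphic_on ball 0 R" unfolding L_def by (intro holomorphic_intros g(1))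
  have eL: "F z = f \<i> * exp (L z)" if "z \<in> ball 0 R" for z
    using g(2)[OF that] egi fi by (simp add: L_def exp_diff field_simps)
  have ReL: "Re (L z) \<le> A" if z: "z \<in> ball 0 R" for z
  proof -
    have "norm (f \<i>) * exp (Re (L z)) = norm (F z)" using eL[OF z] by (simp add: norm_mult)
    also have "\<dots> \<le> exp ((2 * R) powr \<sigma>)" using z R8 by (intro Fbound) auto
    finally have "exp (ln (norm (f \<i>)) + Re (L z)) \<le> exp ((2 * R) powr \<sigma>)"
      using fi by (simp add: exp_add)
    then show ?thesis unfolding A_def by simp
  qed
  have dL: "deriv L 0 = 0"
  proof -
    have z0: "0 \<in> ball (0::complex) R" using R8 by simp
    have dL0: "(L has_field_derivative deriv L 0) (at 0)"
      by (rule holomorphic_derivI[OF L _ z0]) auto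
    have "((\<lambda>z. f \<i> * exp (L z)) has_field_derivative f \<i> * (exp (L 0) * deriv L 0)) (at 0)"
      by (auto intro!: derivative_eq_intros dL0)
    then have "(F has_field_derivative f \<i> * (exp (L 0) * deriv L 0)) (at 0)"
      by (rule has_field_derivative_transform_within_open[where S = "ball 0 R"])
        (use eL z0 in auto)
    then have "deriv F 0 = f \<i> * (exp (L 0) * deriv L 0)" by (rule DERIV_imp_deriv)
    then show ?thesis using dF fi by simp
  qed
  have zR: "z \<in> ball 0 R" using z \<rho> by simp
  have "f z = f \<i> * exp (L z) * W z" using F(3)[of z] eL[OF zR] by simp
  then have 1: "W z = f z / f \<i> * exp (- L z)" using fi by (simp add: exp_minus field_simps)
  have "norm (L z) \<le> 512 * A * \<rho>\<^sup>2 / R\<^sup>2"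
    by (rule holomorphic_critical_bound[OF L _ dL A ReL \<rho> z]) (simp_all add: L_def)
  with 1 show ?thesis unfolding W_def A_def by (intro exI[of _ "L z"]) simp
qed

text \<open>
  Hadamard's factorisation in the case of genus 0 in \<open>z\<^sup>2\<close>. The error exponent in
  \<open>truncated_prod_approx\<close> is at most a multiple of \<open>R powr (\<sigma> - 2) + 1 / R\<^sup>2\<close> and tends to 0
  because \<open>\<sigma> < 2\<close>.
\<close>
theorem truncated_prod_uniform_limit:
  assumes f: "f holomorphic_on UNIV" and ev: "\<And>z. f (- z) = f z" and nz: "f w \<noteq> 0"
    and ord: "entire_order f < 2"
    and rr: "\<And>z. f z = 0 \<Longrightarrow> z \<in> \<real>"
  shows "uniform_limit (ball 0 \<rho>) (\<lambda>k. truncated_prod f (real k)) (\<lambda>z. f z / f \<i>) sequentially"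
proof (rule uniform_limit_on_subset)
  define r where "r = max \<rho> 1"
  show "ball 0 \<rho> \<subseteq> cball 0 r" by (auto simp: r_def)
  obtain \<sigma> R0 where \<sigma>: "\<sigma> < 2" and growth: "\<And>z. norm z \<ge> R0 \<Longrightarrow> norm (f z) \<le> exp (norm z powr \<sigma>)"
    using entire_order_growth[OF f ord] by blast
  have "compact ((\<lambda>z. norm (f z / f \<i>)) ` cball 0 r)"
    using rr[of \<i>] by (intro compact_continuous_image continuous_intros holomorphic_on_imp_continuous_on
            holomorphic_on_subset[OF f]) (auto simp: complex_is_Real_iff)
  then have "bounded ((\<lambda>z. norm (f z / f \<i>)) ` cball 0 r)" by (rule compact_imp_bounded)
  then obtain B where B: "B > 0" "\<And>z. z \<in> cball 0 r \<Longrightarrow> norm (f z / f \<i>) \<le> B"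
    unfolding bounded_pos by auto
  define \<delta> where "\<delta> R = 512 * ((2 * R) powr \<sigma> + \<bar>ln (norm (f \<i>))\<bar> + 1) * r\<^sup>2 / R\<^sup>2" for R
  have \<delta>lim: "(\<lambda>k. \<delta> (real k)) \<longlonglongrightarrow> 0"
  proof -
    have "((\<lambda>R. R powr (\<sigma> - 2)) \<longlongrightarrow> 0) at_top" by (rule tendsto_neg_powr) (use \<sigma> filterlim_ident in auto)
    moreover have "((\<lambda>R::real. 1 / R\<^sup>2) \<longlongrightarrow> 0) at_top" by real_asymp
    ultimately have "((\<lambda>R. 512 * r\<^sup>2 * (2 powr \<sigma> * R powr (\<sigma> - 2) +
        (\<bar>ln (norm (f \<i>))\<bar> + 1) * (1 / R\<^sup>2))) \<longlongrightarrow> 512 * r\<^sup>2 * (2 powr \<sigma> * 0 + (\<bar>ln (norm (f \<i>))\<bar> + 1) * 0)) at_top"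
      by (intro tendsto_intros)
    then have "(\<delta> \<longlongrightarrow> 0) at_top"
    proof (rule Lim_transform_eventually[THEN tendsto_eq_rhs])
      show "eventually (\<lambda>R. 512 * r\<^sup>2 * (2 powr \<sigma> * R powr (\<sigma> - 2) +
        (\<bar>ln (norm (f \<i>))\<bar> + 1) * (1 / R\<^sup>2)) = \<delta> R) at_top"
        using eventually_gt_at_top[of 0]
        by eventually_elim (simp add: \<delta>_def powr_mult powr_diff field_simps)
    qed simp
    then show ?thesis by (rule filterlim_compose[OF _ filterlim_real_sequentially])
  qed
  show "uniform_limit (cball 0 r) (\<lambda>k. truncated_prod f (real k)) (\<lambda>z. f z / f \<i>) sequentially"
  proof (rule uniform_limitI)
    fix e :: real assume e: "e > 0"
    have "((\<lambda>u::complex. exp (- u)) \<longlongrightarrow> exp (- 0)) (nhds 0)"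
      by (intro tendsto_intros filterlim_ident)
    then have "eventually (\<lambda>u::complex. dist (exp (- u)) 1 < e / B) (nhds 0)"
      using e B by (auto simp: tendsto_iff)
    then obtain d where d: "d > 0" "\<And>u::complex. norm u < d \<Longrightarrow> dist (exp (- u)) 1 < e / B"
      by (auto simp: eventually_nhds_metric)
    have "eventually (\<lambda>k. \<delta> (real k) < d) sequentially"
      using order_tendstoD(2)[OF \<delta>lim d(1)] .
    moreover have "eventually (\<lambda>k. real k \<ge> max (8 * r) R0) sequentially"
      using filterlim_real_sequentially unfolding filterlim_at_top by blast
    ultimately show "eventually (\<lambda>k. \<forall>z\<in>cball 0 r. dist (truncated_prod f (real k) z) (f z / f \<i>) < e) sequentially"
    proof eventually_elim
      case (elim k)
      show ?case
      proof
        fix z :: complex assume z: "z \<in> cball 0 r"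
        have "\<exists>u. truncated_prod f (real k) z = f z / f \<i> * exp (- u) \<and> norm u \<le> \<delta> (real k)"
          unfolding \<delta>_def
          by (rule truncated_prod_approx[OF f ev nz rr growth]) (use elim z in \<open>auto simp: r_def\<close>)
        then obtain u where u: "truncated_prod f (real k) z = f z / f \<i> * exp (- u)" "norm u \<le> \<delta> (real k)"
          by blast
        have "dist (truncated_prod f (real k) z) (f z / f \<i>) = norm (f z / f \<i> * (exp (- u) - 1))"
          unfolding u(1) dist_norm by (simp only: right_diff_distrib mult_1_right)
        also have "\<dots> = norm (f z / f \<i>) * dist (exp (- u)) 1"
          by (simp add: norm_mult norm_divide dist_norm)
        also have "\<dots> \<le> B * dist (exp (- u)) 1" using B(2)[OF z] by (intro mult_right_mono) auto
        also have "\<dots> < B * (e / B)" using d(2)[of u] u(2) elim B(1) by (intro mult_strict_left_mono) auto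
        also have "\<dots> = e" using B(1) by simp
        finally show "dist (truncated_prod f (real k) z) (f z / f \<i>) < e" .
      qed
    qed
  qed
qed

section \<open>Derivatives at the origin of the truncated products\<close>

lemma higher_deriv_poly:
  fixes p :: "complex poly"
  shows "(deriv ^^ n) (poly p) = poly ((pderiv ^^ n) p)"
proof (induction n)
  case (Suc n)
  then show ?case by (auto intro!: ext DERIV_imp_deriv poly_DERIV)
qed simp

lemma higher_deriv_poly_0:
  fixes p :: "complex poly"
  shows "(deriv ^^ n) (poly p) 0 = fact n * coeff p n"
  using coeff_higher_pderiv[of n p 0]
  by (simp add: higher_deriv_poly poly_0_coeff_0 pochhammer_fact)

lemma coeff_complex_neg_root_poly:
  assumes "finite I"
  shows "coeff (\<Prod>i\<in>I. [:complex_of_real (l i), 1:]) n = of_real (coeff (neg_root_poly l I) n)"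
  using assms
proof (induction I arbitrary: n rule: finite_induct)
  case empty
  then show ?case by (cases n) (auto simp: neg_root_poly_def)
next
  case (insert x F)
  then show ?case by (cases n) (auto simp: neg_root_poly_def)
qed

text \<open>
  Each root \<open>x\<close> is repeated as the pairs \<open>(x, j)\<close> with \<open>j < pair_mult f x\<close>, which makes the
  truncated product a product of linear factors in \<open>- z\<^sup>2\<close> indexed by a finite set.
\<close>
definition root_index :: "(complex \<Rightarrow> complex) \<Rightarrow> real \<Rightarrow> (real \<times> nat) set" where
  "root_index f R = (SIGMA x:{x\<in>nonneg_zeros f. x < R}. {..<pair_mult f x})"

definition trunc_coeff :: "(complex \<Rightarrow> complex) \<Rightarrow> real \<Rightarrow> nat \<Rightarrow> real" where
  "trunc_coeff f R n = coeff (neg_root_poly (\<lambda>i. (fst i)\<^sup>2) (root_index f R)) n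
      / (\<Prod>i\<in>root_index f R. 1 + (fst i)\<^sup>2)"

lemma truncated_prod_index:
  assumes "finite {x\<in>nonneg_zeros f. x < R}"
  shows "truncated_prod f R z = (\<Prod>i\<in>root_index f R. (of_real ((fst i)\<^sup>2) - z\<^sup>2) / of_real (1 + (fst i)\<^sup>2))"
proof -
  let ?g = "\<lambda>x::real. (of_real (x\<^sup>2) - z\<^sup>2) / complex_of_real (1 + x\<^sup>2)"
  have "(\<Prod>i\<in>root_index f R. ?g (fst i)) = (\<Prod>x\<in>{x\<in>nonneg_zeros f. x < R}. \<Prod>j<pair_mult f x. ?g x)"
    unfolding root_index_def using assms by (subst prod.Sigma) (auto simp: case_prod_unfold)
  then show ?thesis by (simp add: truncated_prod_def paired_prod_def)
qed

lemma higher_deriv_truncated_prod: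
  assumes fin: "finite {x\<in>nonneg_zeros f. x < R}"
  shows "(deriv ^^ (2 * n)) (truncated_prod f R) 0 = fact (2 * n) * (-1) ^ n * of_real (trunc_coeff f R n)"
    and "odd m \<Longrightarrow> (deriv ^^ m) (truncated_prod f R) 0 = 0"
proof -
  define I where "I = root_index f R"
  define l where "l = (\<lambda>i::real \<times> nat. (fst i)\<^sup>2)"
  define C where "C = (\<Prod>i\<in>I. 1 + l i)"
  define P where "P = (\<Prod>i\<in>I. [:complex_of_real (l i), 1:])"
  define Q where "Q = (\<Sum>k\<le>degree P. monom ((-1) ^ k * coeff P k / of_real C) (2 * k))"
  have finI: "finite I" unfolding I_def root_index_def using fin by auto
  have "truncated_prod f R z = poly Q z" for z
  proof -
    have "truncated_prod f R z = (\<Prod>i\<in>I. (of_real (l i) - z\<^sup>2) / of_real (1 + l i))"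
      unfolding I_def l_def by (rule truncated_prod_index[OF fin])
    also have "\<dots> = poly P (- (z\<^sup>2)) / of_real C"
      by (simp add: prod_dividef P_def poly_prod C_def)
    also have "\<dots> = poly Q z"
      unfolding poly_altdef[of P] Q_def poly_sum poly_monom sum_divide_distrib
      by (intro sum.cong refl) (simp add: power_minus[of "z\<^sup>2"] power_mult)
    finally show ?thesis .
  qed
  then have eq: "truncated_prod f R = poly Q" by auto
  have cQ: "coeff Q (2 * n) = (-1) ^ n * of_real (trunc_coeff f R n)" for n
  proof -
    have "coeff Q (2 * n) = (\<Sum>k\<le>degree P. if k = n then (-1) ^ k * coeff P k / of_real C else 0)"
      unfolding Q_def coeff_sum by (intro sum.cong) auto
    also have "\<dots> = (-1) ^ n * coeff P n / of_real C"
      by (cases "n \<le> degree P") (auto simp: coeff_eq_0)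
    also have "coeff P n = of_real (coeff (neg_root_poly l I) n)"
      unfolding P_def by (rule coeff_complex_neg_root_poly[OF finI])
    finally show ?thesis by (simp add: trunc_coeff_def I_def l_def C_def)
  qed
  show "(deriv ^^ (2 * n)) (truncated_prod f R) 0 = fact (2 * n) * (-1) ^ n * of_real (trunc_coeff f R n)"
    unfolding eq higher_deriv_poly_0 cQ by simp
  assume "odd m"
  then have "coeff Q m = 0" unfolding Q_def coeff_sum by (intro sum.neutral) auto
  then show "(deriv ^^ m) (truncated_prod f R) 0 = 0"
    unfolding eq higher_deriv_poly_0 by simp
qed

section \<open>Asymptotics of the Taylor coefficients\<close>

lemma ratio_tendsto_1I:
  fixes s t :: "nat \<Rightarrow> real"
  assumes pos: "eventually (\<lambda>n. s n > 0) F"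
    and bd: "\<And>e. e > 1 \<Longrightarrow> eventually (\<lambda>n. s n / e \<le> t n \<and> t n \<le> e * s n) F"
  shows "((\<lambda>n. t n / s n) \<longlongrightarrow> 1) F"
proof (rule order_tendstoI)
  fix a :: real assume a: "a > 1"
  define e where "e = (1 + a) / 2"
  have e: "1 < e" "e < a" using a by (auto simp: e_def)
  from pos bd[OF e(1)] show "eventually (\<lambda>n. t n / s n < a) F"
  proof eventually_elim
    case (elim n)
    then have "t n / s n \<le> e" by (simp add: pos_divide_le_eq)
    then show ?case using e by simp
  qed
next
  fix a :: real assume a: "a < 1"
  define b where "b = max a (1/2)"
  define e where "e = 2 / (1 + b)"
  have b: "0 < b" "b < 1" "a \<le> b" using a by (auto simp: b_def)
  have e: "1 < e" "1 / e > b" using b by (auto simp: e_def field_simps)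
  from pos bd[OF e(1)] show "eventually (\<lambda>n. a < t n / s n) F"
  proof eventually_elim
    case (elim n)
    then have "1 / e * s n \<le> t n" by simp
    then have "1 / e \<le> t n / s n" using elim by (simp add: pos_le_divide_eq)
    then show ?case using e b by simp
  qed
qed

locale even_real_rooted =
  fixes f :: "complex \<Rightarrow> complex" and \<alpha> :: real
  assumes entire: "f holomorphic_on UNIV"
    and even_f: "\<And>z. f (- z) = f z"
    and order_lt: "entire_order f < 2"
    and real_roots: "\<And>z. f z = 0 \<Longrightarrow> z \<in> \<real>"
    and \<alpha>: "0 < \<alpha>" "\<alpha> < 2"
    and reg_var: "\<And>x::real. x > 0 \<Longrightarrow>
          ((\<lambda>r. real (n_plus f (x * r)) / real (n_plus f r)) \<longlongrightarrow> x powr \<alpha>) at_top"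
begin

lemma f_i_nonzero: "f \<i> \<noteq> 0"
  using real_roots[of \<i>] by (auto simp: complex_is_Real_iff)

lemma finite_zeros: "finite {x\<in>nonneg_zeros f. x \<le> R}" "finite {x\<in>nonneg_zeros f. x < R}"
  using finite_nonneg_zeros[OF entire f_i_nonzero, of R]
  by (auto elim: finite_subset[rotated])

text \<open>
  The Taylor coefficients of \<open>f z / f \<i>\<close> in powers of \<open>- z\<^sup>2\<close>. They are real by
  \<open>higher_deriv_even\<close>, so taking the real part loses nothing.
\<close>
definition taylor_abs :: "nat \<Rightarrow> real" where
  "taylor_abs n = Re ((-1) ^ n * (deriv ^^ (2 * n)) f 0 / (f \<i> * fact (2 * n)))"

lemma trunc_deriv_tendsto:
  "(\<lambda>k. (deriv ^^ m) (truncated_prod f (real k)) 0) \<longlonglongrightarrow> (deriv ^^ m) f 0 / f \<i>"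
proof -
  have "(\<lambda>k. (deriv ^^ m) (truncated_prod f (real k)) 0) \<longlonglongrightarrow> (deriv ^^ m) (\<lambda>z. f z / f \<i>) 0"
  proof (rule higher_deriv_complex_uniform_limit)
    show "uniform_limit (ball 0 1) (\<lambda>k. truncated_prod f (real k)) (\<lambda>z. f z / f \<i>) sequentially"
      by (rule truncated_prod_uniform_limit[OF entire even_f f_i_nonzero order_lt real_roots])
  qed (auto simp: truncated_prod_def intro!: always_eventually holomorphic_intros)
  also have "(deriv ^^ m) (\<lambda>z. f z / f \<i>) 0 = (deriv ^^ m) f 0 / f \<i>"
    using higher_deriv_cmult[OF entire, of 0 m "inverse (f \<i>)"] by (simp add: field_simps)
  finally show ?thesis .
qed

lemma trunc_coeff_tendsto: "(\<lambda>k. trunc_coeff f (real k) n) \<longlonglongrightarrow> taylor_abs n"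
  and higher_deriv_even: "(deriv ^^ (2 * n)) f 0 = f \<i> * fact (2 * n) * (-1) ^ n * of_real (taylor_abs n)"
proof -
  define c where "c = (-1) ^ n * (deriv ^^ (2 * n)) f 0 / (f \<i> * fact (2 * n))"
  have "(\<lambda>k. (-1) ^ n / fact (2 * n) * (deriv ^^ (2 * n)) (truncated_prod f (real k)) 0)
      \<longlonglongrightarrow> (-1) ^ n / fact (2 * n) * ((deriv ^^ (2 * n)) f 0 / f \<i>)"
    by (intro tendsto_intros trunc_deriv_tendsto)
  also have "(-1) ^ n / fact (2 * n) * ((deriv ^^ (2 * n)) f 0 / f \<i>) = c"
    by (simp add: c_def)
  also have "(\<lambda>k. (-1) ^ n / fact (2 * n) * (deriv ^^ (2 * n)) (truncated_prod f (real k)) 0)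
      = (\<lambda>k. complex_of_real (trunc_coeff f (real k) n))"
    unfolding higher_deriv_truncated_prod(1)[OF finite_zeros(2)] by (simp add: power_mult_distrib[symmetric])
  finally have lim: "(\<lambda>k. complex_of_real (trunc_coeff f (real k) n)) \<longlonglongrightarrow> c" .
  from tendsto_Re[OF this] show "(\<lambda>k. trunc_coeff f (real k) n) \<longlonglongrightarrow> taylor_abs n"
    by (simp add: taylor_abs_def c_def)
  then have "(\<lambda>k. complex_of_real (trunc_coeff f (real k) n)) \<longlonglongrightarrow> of_real (taylor_abs n)"
    by (rule tendsto_of_real)
  with lim have c: "c = of_real (taylor_abs n)" by (rule LIMSEQ_unique)
  have "f \<i> * fact (2 * n) * (-1) ^ n * c = (deriv ^^ (2 * n)) f 0"
    using f_i_nonzero by (simp add: c_def power_mult_distrib[symmetric])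
  then show "(deriv ^^ (2 * n)) f 0 = f \<i> * fact (2 * n) * (-1) ^ n * of_real (taylor_abs n)"
    by (simp add: c)
qed

lemma higher_deriv_odd: "odd m \<Longrightarrow> (deriv ^^ m) f 0 = 0"
  using LIMSEQ_unique[OF trunc_deriv_tendsto[of m] tendsto_eventually[of _ 0]]
    higher_deriv_truncated_prod(2)[OF finite_zeros(2)] f_i_nonzero by auto

lemma finite_root_index: "finite (root_index f R)"
  unfolding root_index_def using finite_zeros by auto

lemma trunc_coeff_denom_pos: "(\<Prod>i\<in>root_index f R. 1 + (fst i)\<^sup>2) > 0"
  by (intro prod_pos ballI) (simp add: add_pos_nonneg)

lemma taylor_abs_nonneg: "taylor_abs n \<ge> 0"
  by (rule LIMSEQ_le_const[OF trunc_coeff_tendsto])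
    (use neg_root_poly_coeff_nonneg[OF finite_root_index] trunc_coeff_denom_pos
      in \<open>auto simp: trunc_coeff_def intro!: divide_nonneg_pos\<close>)

lemma taylor_abs_log_concave:
  assumes "i \<le> j"
  shows "taylor_abs i * taylor_abs (j + 2) \<le> taylor_abs (i + 1) * taylor_abs (j + 1)"
proof (rule LIMSEQ_le)
  let ?t = "\<lambda>k. trunc_coeff f (real k)"
  show "(\<lambda>k. ?t k i * ?t k (j + 2)) \<longlonglongrightarrow> taylor_abs i * taylor_abs (j + 2)"
    "(\<lambda>k. ?t k (i + 1) * ?t k (j + 1)) \<longlonglongrightarrow> taylor_abs (i + 1) * taylor_abs (j + 1)"
    by (intro tendsto_mult trunc_coeff_tendsto)+
  have "?t k i * ?t k (j + 2) \<le> ?t k (i + 1) * ?t k (j + 1)" for k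
    unfolding trunc_coeff_def times_divide_times_eq
    by (intro divide_right_mono neg_root_poly_log_concave finite_root_index assms)
      (use trunc_coeff_denom_pos[of "real k"] in auto)
  then show "\<exists>N. \<forall>k\<ge>N. ?t k i * ?t k (j + 2) \<le> ?t k (i + 1) * ?t k (j + 1)" by blast
qed

text \<open>
  It differs from \<open>n_plus f\<close> only in that a root at the origin is counted with half its order,
  as it occurs in the product over pairs of roots.
\<close>
definition pair_count :: "real \<Rightarrow> real" where
  "pair_count y = (\<Sum>x\<in>{x\<in>nonneg_zeros f. x \<le> y}. real (pair_mult f x))"

lemma pair_count_mono: "mono pair_count"
  unfolding pair_count_def by (intro monoI sum_mono2 finite_zeros) auto

lemma pair_count_nonneg: "pair_count y \<ge> 0"
  unfolding pair_count_def by (intro sum_nonneg) auto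

lemma n_plus_alt: "real (n_plus f r) = (\<Sum>x\<in>{x\<in>nonneg_zeros f. x \<le> r}. real (nat (zorder f (of_real x))))"
proof -
  have "{x. x \<in> {0..r} \<and> f (of_real x) = 0} = {x\<in>nonneg_zeros f. x \<le> r}"
    by (auto simp: nonneg_zeros_def)
  then show ?thesis by (simp add: n_plus_def)
qed

lemma n_plus_mono: "mono (\<lambda>r. real (n_plus f r))"
  unfolding n_plus_alt by (intro monoI sum_mono2 finite_zeros) auto

lemma n_plus_at_top: "filterlim (\<lambda>r. real (n_plus f r)) at_top at_top"
  by (rule regularly_varying_at_top[OF n_plus_mono _ \<alpha>(1) reg_var]) auto

lemma n_plus_pair_count: "pair_count r \<le> real (n_plus f r)" "real (n_plus f r) \<le> pair_count r + real (pair_mult f 0)"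
proof -
  have z0: "real (nat (zorder f 0)) = 2 * real (pair_mult f 0)"
    using even_zorder_0[OF entire even_f f_i_nonzero] by (simp add: pair_mult_def real_of_nat_div)
  show "pair_count r \<le> real (n_plus f r)"
    unfolding n_plus_alt pair_count_def by (intro sum_mono) (use z0 in \<open>auto simp: pair_mult_def\<close>)
  have "real (n_plus f r) \<le> (\<Sum>x\<in>{x\<in>nonneg_zeros f. x \<le> r}. real (pair_mult f x)
      + (if x = 0 then real (pair_mult f 0) else 0))"
    unfolding n_plus_alt by (intro sum_mono) (use z0 in \<open>auto simp: pair_mult_def\<close>)
  also have "\<dots> \<le> pair_count r + real (pair_mult f 0)"
    unfolding sum.distrib pair_count_def using finite_zeros(1)[of r] by (auto simp: sum.delta)
  finally show "real (n_plus f r) \<le> pair_count r + real (pair_mult f 0)" .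
qed

lemma pair_count_n_plus: "((\<lambda>r. pair_count r / real (n_plus f r)) \<longlongrightarrow> 1) at_top"
proof (rule tendsto_sandwich)
  define c where "c = real (pair_mult f 0)"
  have pos: "eventually (\<lambda>r. real (n_plus f r) > 0) at_top"
    using n_plus_at_top unfolding filterlim_at_top_dense by blast
  then show "eventually (\<lambda>r. 1 - c / real (n_plus f r) \<le> pair_count r / real (n_plus f r)) at_top"
  proof eventually_elim
    case (elim r)
    have "(real (n_plus f r) - c) / real (n_plus f r) \<le> pair_count r / real (n_plus f r)"
      using n_plus_pair_count(2)[of r] by (intro divide_right_mono) (auto simp: c_def)
    then show ?case using elim by (simp add: diff_divide_distrib)
  qed
  show "eventually (\<lambda>r. pair_count r / real (n_plus f r) \<le> 1) at_top"
    using pos by eventually_elim (use n_plus_pair_count(1) in auto)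
  have "((\<lambda>r. c / real (n_plus f r)) \<longlongrightarrow> 0) at_top"
    by (rule tendsto_divide_0[OF tendsto_const filterlim_at_top_imp_at_infinity[OF n_plus_at_top]])
  from tendsto_diff[OF tendsto_const this, of 1]
  show "((\<lambda>r. 1 - c / real (n_plus f r)) \<longlongrightarrow> 1) at_top" by simp
qed auto

lemma pair_count_reg_var:
  assumes x: "x > 0"
  shows "((\<lambda>r. pair_count (x * r) / pair_count r) \<longlongrightarrow> x powr \<alpha>) at_top"
proof -
  let ?N = "\<lambda>r. real (n_plus f r)"
  have xr: "filterlim (\<lambda>r. x * r) at_top at_top"
    by (rule filterlim_tendsto_pos_mult_at_top[OF tendsto_const x filterlim_ident])
  have "((\<lambda>r. (pair_count (x * r) / ?N (x * r)) * (?N (x * r) / ?N r) / (pair_count r / ?N r)) \<longlongrightarrow> 1 * x powr \<alpha> / 1) at_top"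
    by (intro tendsto_intros reg_var x pair_count_n_plus filterlim_compose[OF pair_count_n_plus xr]) auto
  then have lim: "((\<lambda>r. (pair_count (x * r) / ?N (x * r)) * (?N (x * r) / ?N r) / (pair_count r / ?N r)) \<longlongrightarrow> x powr \<alpha>) at_top"
    by simp
  have pos: "eventually (\<lambda>r. ?N r > 0) at_top"
    using n_plus_at_top unfolding filterlim_at_top_dense by blast
  have "eventually (\<lambda>r. ?N (x * r) > 0) at_top"
    using filterlim_compose[OF n_plus_at_top xr] unfolding filterlim_at_top_dense by blast
  with pos have "eventually (\<lambda>r. (pair_count (x * r) / ?N (x * r)) * (?N (x * r) / ?N r) / (pair_count r / ?N r) = pair_count (x * r) / pair_count r) at_top"
    by eventually_elim auto
  with lim show ?thesis by (rule Lim_transform_eventually)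
qed

lemma infinite_zeros: "infinite (nonneg_zeros f)"
proof
  assume fin: "finite (nonneg_zeros f)"
  define B where "B = (\<Sum>x\<in>nonneg_zeros f. real (nat (zorder f (of_real x))))"
  have le: "real (n_plus f r) \<le> B" for r
    unfolding n_plus_alt B_def by (intro sum_mono2 fin) auto
  have "eventually (\<lambda>r. real (n_plus f r) > B) at_top"
    using n_plus_at_top unfolding filterlim_at_top_dense by blast
  then obtain r where "real (n_plus f r) > B" using eventually_happens by force
  then show False using le[of r] by simp
qed

text \<open>
  Otherwise \<open>f\<close> would be a polynomial and have only finitely many roots.
\<close>
lemma infinitely_many_taylor: "\<exists>m\<ge>k. taylor_abs m \<noteq> 0"
proof (rule ccontr)
  assume "\<not> ?thesis"
  then have 0: "taylor_abs m = 0" if "m \<ge> k" for m using that by auto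
  have d0: "(deriv ^^ m) f 0 = 0" if m: "m \<ge> 2 * k" for m
  proof (cases "odd m")
    case False
    then obtain n where "m = 2 * n" by auto
    then show ?thesis using higher_deriv_even[of n] 0[of n] m by simp
  qed (rule higher_deriv_odd)
  define p where "p = (\<Sum>m<2 * k. monom ((deriv ^^ m) f 0 / fact m) m)"
  have fp: "f z = poly p z" for z
  proof -
    have "(\<lambda>m. (deriv ^^ m) f 0 / fact m * (z - 0) ^ m) sums f z"
      by (rule holomorphic_power_series[of f 0 "norm z + 1"]) (auto intro: holomorphic_on_subset[OF entire])
    moreover have "(\<lambda>m. (deriv ^^ m) f 0 / fact m * (z - 0) ^ m) sums
        (\<Sum>m<2 * k. (deriv ^^ m) f 0 / fact m * (z - 0) ^ m)"
      by (rule sums_finite) (use d0 in auto)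
    ultimately have "f z = (\<Sum>m<2 * k. (deriv ^^ m) f 0 / fact m * (z - 0) ^ m)" by (rule sums_unique2)
    then show ?thesis by (simp add: p_def poly_sum poly_monom)
  qed
  have "p \<noteq> 0" using fp[of \<i>] f_i_nonzero by auto
  then have "finite {z. poly p z = 0}" by (rule poly_roots_finite)
  then have "finite (complex_of_real ` nonneg_zeros f)"
    by (rule finite_subset[rotated]) (auto simp: nonneg_zeros_def fp)
  then have "finite (nonneg_zeros f)" by (rule finite_imageD) (auto simp: inj_on_def)
  then show False using infinite_zeros by simp
qed

text \<open>
  By log-concavity the support of the sequence is an interval, and it is infinite.
\<close>
lemma taylor_abs_eventually_pos: "\<exists>n0. \<forall>n\<ge>n0. taylor_abs n > 0"
proof -
  obtain i where i: "taylor_abs i \<noteq> 0" using infinitely_many_taylor[of 0] by blast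
  then have ip: "taylor_abs i > 0" using taylor_abs_nonneg[of i] by simp
  have "taylor_abs n \<noteq> 0" if n: "n \<ge> i" for n
  proof
    assume n0: "taylor_abs n = 0"
    have "taylor_abs m = 0" if "m \<ge> n" for m
      using that
    proof (induction m rule: dec_induct)
      case (step m)
      then have "m > i" using n i n0 by (metis le_less_trans order_le_less)
      then obtain m' where m': "m = Suc m'" "i \<le> m'" by (cases m) auto
      have "taylor_abs i * taylor_abs (Suc m) \<le> 0"
        using taylor_abs_log_concave[OF m'(2)] m'(1) step by simp
      then show ?case using ip taylor_abs_nonneg[of "Suc m"] by (simp add: mult_le_0_iff)
    qed (rule n0)
    then show False using infinitely_many_taylor[of n] by auto
  qed
  then show ?thesis using taylor_abs_nonneg by (metis less_eq_real_def)
qed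

text \<open>
  By \<open>trunc_mean_tendsto\<close> this is \<open>(\<Sum>x. t / (t + x\<^sup>2))\<close> over the roots \<open>x \<ge> 0\<close>. The integral form
  makes its existence and its asymptotics available at once.
\<close>
definition root_mean :: "real \<Rightarrow> real" where "root_mean t = level_mean pair_count (sqrt t)"

definition trunc_mean :: "nat \<Rightarrow> real \<Rightarrow> real" where
  "trunc_mean k t = (\<Sum>i\<in>root_index f (real k). t / (t + (fst i)\<^sup>2))"

lemma trunc_mean_alt:
  assumes "t > 0"
  shows "trunc_mean k t = (\<Sum>x\<in>{x\<in>nonneg_zeros f. x < real k}. real (pair_mult f x) * ((sqrt t)\<^sup>2 / ((sqrt t)\<^sup>2 + x\<^sup>2)))"
proof -
  have "trunc_mean k t = (\<Sum>x\<in>{x\<in>nonneg_zeros f. x < real k}. \<Sum>j<pair_mult f x. t / (t + x\<^sup>2))"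
    unfolding trunc_mean_def root_index_def using finite_zeros by (subst sum.Sigma) (auto simp: case_prod_unfold)
  then show ?thesis using assms by simp
qed

lemma trunc_mean_tendsto: "t > 0 \<Longrightarrow> (\<lambda>k. trunc_mean k t) \<longlonglongrightarrow> root_mean t"
  and trunc_mean_le_root_mean: "t > 0 \<Longrightarrow> trunc_mean k t \<le> root_mean t"
proof -
  assume t: "t > 0"
  have nonneg: "x \<ge> 0" if "x \<in> nonneg_zeros f" for x using that by (simp add: nonneg_zeros_def)
  have pair_count_eq: "pair_count = (\<lambda>y. \<Sum>x\<in>{x\<in>nonneg_zeros f. x \<le> y}. real (pair_mult f x))"
    by (rule ext) (rule pair_count_def)
  note lim = level_mean_counting[of "nonneg_zeros f" "\<lambda>x. real (pair_mult f x)" \<alpha> "sqrt t",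
      OF nonneg finite_zeros(1) of_nat_0_le_iff pair_count_reg_var[unfolded pair_count_def] \<alpha>]
  show "(\<lambda>k. trunc_mean k t) \<longlonglongrightarrow> root_mean t" "trunc_mean k t \<le> root_mean t"
    unfolding root_mean_def trunc_mean_alt[OF t] pair_count_eq by (rule lim; use t in simp)+
qed

lemma trunc_mean_scale:
  assumes t: "t > 0" "t' > 0"
  shows "trunc_mean k t' \<le> max 1 (t' / t) * trunc_mean k t"
proof -
  have "t' / (t' + x) \<le> max 1 (t' / t) * (t / (t + x))" if x: "x \<ge> 0" for x
  proof (cases "t' \<le> t")
    case True
    then have "t' * x \<le> t * x" using x by (intro mult_right_mono)
    then show ?thesis using True t x by (simp add: max_def frac_le_eq divide_simps) (simp add: algebra_simps)
  next
    case False
    then have "t' / (t' + x) \<le> t' / (t + x)" using False t x by (intro divide_left_mono) auto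
    also have "\<dots> = (t' / t) * (t / (t + x))" using t by simp
    finally show ?thesis using False t by (simp add: max_def)
  qed
  then show ?thesis unfolding trunc_mean_def sum_distrib_left by (intro sum_mono) auto
qed

text \<open>
  Two facts in one: \<open>root_mean\<close> is nondecreasing, and \<open>root_mean t / t\<close> is nonincreasing.
\<close>
lemma root_mean_scale:
  assumes t: "t > 0" "t' > 0"
  shows "root_mean t' \<le> max 1 (t' / t) * root_mean t"
proof (rule LIMSEQ_le)
  show "(\<lambda>k. trunc_mean k t') \<longlonglongrightarrow> root_mean t'" "(\<lambda>k. max 1 (t' / t) * trunc_mean k t) \<longlonglongrightarrow> max 1 (t' / t) * root_mean t"
    by (intro tendsto_intros trunc_mean_tendsto t)+
qed (use trunc_mean_scale[OF t] in auto)

definition coeff_ratio :: "nat \<Rightarrow> real" where "coeff_ratio n = taylor_abs n / taylor_abs (Suc n)"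

text \<open>
  Passage to the limit in \<open>coeff_ratio_mean_bounds\<close>. The ratio \<open>qk\<close> of the truncated
  coefficients varies with the truncation, so the upper bound is first taken for a fixed
  partial sum \<open>trunc_mean j\<close>, and the lower bound uses \<open>root_mean_scale\<close> to compare \<open>qk\<close> with its
  limit.
\<close>
lemma mean_bounds:
  assumes pos: "taylor_abs n > 0" "taylor_abs (Suc n) > 0"
  shows "real n \<le> root_mean (coeff_ratio n)" "root_mean (coeff_ratio n) \<le> real (Suc n)"
proof -
  define qk where "qk k = trunc_coeff f (real k) n / trunc_coeff f (real k) (Suc n)" for k
  have qp: "coeff_ratio n > 0" using pos by (simp add: coeff_ratio_def)
  have qk_lim: "qk \<longlonglongrightarrow> coeff_ratio n"
    unfolding qk_def[abs_def] coeff_ratio_def by (intro tendsto_divide trunc_coeff_tendsto) (use pos in auto)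
  have ev: "eventually (\<lambda>k. trunc_coeff f (real k) n > 0 \<and> trunc_coeff f (real k) (Suc n) > 0) sequentially"
    using order_tendstoD(1)[OF trunc_coeff_tendsto pos(1)] order_tendstoD(1)[OF trunc_coeff_tendsto pos(2)]
    by eventually_elim auto
  have bnd: "eventually (\<lambda>k. qk k > 0 \<and> real n \<le> trunc_mean k (qk k) \<and> trunc_mean k (qk k) \<le> real (Suc n)) sequentially"
    using ev
  proof eventually_elim
    case (elim k)
    let ?p = "neg_root_poly (\<lambda>i. (fst i)\<^sup>2) (root_index f (real k))"
    have pp: "coeff ?p n > 0" "coeff ?p (Suc n) > 0"
      using elim trunc_coeff_denom_pos[of "real k"] by (auto simp: trunc_coeff_def zero_less_divide_iff)
    have qk: "qk k = coeff ?p n / coeff ?p (Suc n)"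
      using trunc_coeff_denom_pos[of "real k"] by (simp add: qk_def trunc_coeff_def)
    show ?case
      using coeff_ratio_mean_bounds[OF finite_root_index _ pp] pp unfolding trunc_mean_def qk by auto
  qed
  show "root_mean (coeff_ratio n) \<le> real (Suc n)"
  proof (rule LIMSEQ_le_const2[OF trunc_mean_tendsto[OF qp]])
    have "trunc_mean j (coeff_ratio n) \<le> real (Suc n)" for j
    proof (rule tendsto_upperbound)
      show "(\<lambda>k. trunc_mean j (qk k)) \<longlonglongrightarrow> trunc_mean j (coeff_ratio n)"
      proof -
        have "coeff_ratio n + (fst i)\<^sup>2 > 0" for i :: "real \<times> nat" using qp by (simp add: add_pos_nonneg)
        then show ?thesis unfolding trunc_mean_def by (intro tendsto_intros qk_lim) (metis less_irrefl)
      qed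
      show "eventually (\<lambda>k. trunc_mean j (qk k) \<le> real (Suc n)) sequentially"
        using bnd eventually_ge_at_top[of j]
      proof eventually_elim
        case (elim k)
        have "trunc_mean j (qk k) \<le> trunc_mean k (qk k)" unfolding trunc_mean_def
          by (intro sum_mono2 finite_root_index) (use elim in \<open>auto simp: root_index_def\<close>)
        then show ?case using elim by linarith
      qed
    qed auto
    then show "\<exists>N. \<forall>j\<ge>N. trunc_mean j (coeff_ratio n) \<le> real (Suc n)" by blast
  qed
  have "(\<lambda>k. max 1 (qk k / coeff_ratio n) * root_mean (coeff_ratio n)) \<longlonglongrightarrow> max 1 (coeff_ratio n / coeff_ratio n) * root_mean (coeff_ratio n)"
    using qp by (intro tendsto_intros tendsto_max qk_lim) auto
  then have "real n \<le> max 1 (coeff_ratio n / coeff_ratio n) * root_mean (coeff_ratio n)"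
  proof (rule tendsto_lowerbound)
    show "eventually (\<lambda>k. real n \<le> max 1 (qk k / coeff_ratio n) * root_mean (coeff_ratio n)) sequentially"
      using bnd
    proof eventually_elim
      case (elim k)
      then show ?case using trunc_mean_le_root_mean[of "qk k" k] root_mean_scale[OF qp, of "qk k"] by linarith
    qed
  qed auto
  then show "real n \<le> root_mean (coeff_ratio n)" using qp by simp
qed

definition n0 :: nat where "n0 = (SOME n0. \<forall>n\<ge>n0. taylor_abs n > 0)"

lemma taylor_abs_pos: "n \<ge> n0 \<Longrightarrow> taylor_abs n > 0"
  using someI_ex[OF taylor_abs_eventually_pos] unfolding n0_def by blast

lemma coeff_ratio_pos: "n \<ge> n0 \<Longrightarrow> coeff_ratio n > 0"
  using taylor_abs_pos[of n] taylor_abs_pos[of "Suc n"] by (simp add: coeff_ratio_def)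

lemma mean_at_coeff_ratio: "n \<ge> n0 \<Longrightarrow> real n \<le> root_mean (coeff_ratio n)" "n \<ge> n0 \<Longrightarrow> root_mean (coeff_ratio n) \<le> real (Suc n)"
  using mean_bounds[of n] taylor_abs_pos[of n] taylor_abs_pos[of "Suc n"] by auto

lemma coeff_ratio_mono:
  assumes "n0 \<le> n" "n \<le> m"
  shows "coeff_ratio n \<le> coeff_ratio m"
  using assms(2)
proof (induction m rule: dec_induct)
  case (step m)
  have p: "taylor_abs m > 0" "taylor_abs (Suc m) > 0" "taylor_abs (Suc (Suc m)) > 0"
    using assms(1) step taylor_abs_pos by auto
  have "coeff_ratio m \<le> coeff_ratio (Suc m)"
    using taylor_abs_log_concave[of m m] p by (simp add: coeff_ratio_def divide_simps mult_ac)
  with step show ?case by simp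
qed simp

text \<open>
  The mean at \<open>coeff_ratio n\<close> is at least \<open>n\<close>, and the mean grows at most linearly.
\<close>
lemma coeff_ratio_at_top: "filterlim coeff_ratio at_top sequentially"
proof (rule filterlim_at_top_mono)
  define g where "g = max 1 (root_mean 1)"
  have g: "g \<ge> 1" by (simp add: g_def)
  show "filterlim (\<lambda>n. real n / g) at_top sequentially"
    using filterlim_tendsto_pos_mult_at_top[OF tendsto_const[of "1 / g"] _ filterlim_real_sequentially] g
    by simp
  have "eventually (\<lambda>n. n \<ge> max n0 (Suc (nat \<lceil>g\<rceil>))) sequentially" by (rule eventually_ge_at_top)
  then show "eventually (\<lambda>n. real n / g \<le> coeff_ratio n) sequentially"
  proof eventually_elim
    case (elim n)
    then have n: "n \<ge> n0" "real n > g" by linarith+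
    have "real n \<le> root_mean (coeff_ratio n)" by (rule mean_at_coeff_ratio(1)[OF n(1)])
    also have "\<dots> \<le> max 1 (coeff_ratio n / 1) * root_mean 1" using coeff_ratio_pos[OF n(1)] by (intro root_mean_scale) auto
    also have "\<dots> \<le> max 1 (coeff_ratio n) * g" by (simp add: g_def mult_left_mono)
    finally have *: "real n \<le> max 1 (coeff_ratio n) * g" .
    then have "coeff_ratio n \<ge> 1" using n(2) by (cases "coeff_ratio n \<ge> 1") (auto simp: max_def)
    then show ?case using * g by (simp add: max_def divide_simps split: if_splits)
  qed
qed

definition coeff_radius :: "nat \<Rightarrow> real" where "coeff_radius n = sqrt (coeff_ratio n)"

lemma coeff_radius_at_top: "filterlim coeff_radius at_top sequentially"
  unfolding coeff_radius_def[abs_def] by (rule filterlim_compose[OF sqrt_at_top coeff_ratio_at_top])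

lemma coeff_radius_pos: "n \<ge> n0 \<Longrightarrow> coeff_radius n > 0"
  using coeff_ratio_pos by (simp add: coeff_radius_def)

text \<open>
  The limit in \<open>level_mean_asymp\<close>. Then \<open>n / mean_const\<close> is the argument of the inverse counting
  function in \<open>scale_seq\<close>.
\<close>
definition mean_const :: real where "mean_const = pi * (\<alpha> / 2) / sin (pi * (\<alpha> / 2))"

lemma mean_const_pos: "mean_const > 0"
proof -
  have "pi * (\<alpha> / 2) < pi * 1" using \<alpha> by (intro mult_strict_left_mono) auto
  then have "sin (pi * (\<alpha> / 2)) > 0" using \<alpha> by (intro sin_gt_zero) auto
  then show ?thesis using \<alpha> by (simp add: mean_const_def)
qed

lemma n_plus_coeff_radius: "(\<lambda>n. real (n_plus f (coeff_radius n)) / (real n / mean_const)) \<longlonglongrightarrow> 1"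
proof -
  let ?N = "\<lambda>r. real (n_plus f r)"
  have 1: "(\<lambda>n. pair_count (coeff_radius n) / ?N (coeff_radius n)) \<longlonglongrightarrow> 1"
    by (rule filterlim_compose[OF pair_count_n_plus coeff_radius_at_top])
  have 2: "(\<lambda>n. level_mean pair_count (coeff_radius n) / pair_count (coeff_radius n)) \<longlonglongrightarrow> mean_const"
    unfolding mean_const_def
    by (rule filterlim_compose[OF level_mean_asymp[OF pair_count_mono pair_count_nonneg pair_count_reg_var \<alpha>] coeff_radius_at_top])
  have 3: "(\<lambda>n. root_mean (coeff_ratio n) / real n) \<longlonglongrightarrow> 1"
  proof (rule tendsto_sandwich)
    show "eventually (\<lambda>n. 1 \<le> root_mean (coeff_ratio n) / real n) sequentially"
      using eventually_ge_at_top[of "max n0 1"]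
      by eventually_elim (use mean_at_coeff_ratio(1) in \<open>auto simp: le_divide_eq\<close>)
    show "eventually (\<lambda>n. root_mean (coeff_ratio n) / real n \<le> real (Suc n) / real n) sequentially"
      using eventually_ge_at_top[of "max n0 1"]
      by eventually_elim (use mean_at_coeff_ratio(2) in \<open>auto intro!: divide_right_mono\<close>)
    show "(\<lambda>n. real (Suc n) / real n) \<longlonglongrightarrow> 1" by (rule LIMSEQ_Suc_n_over_n)
  qed auto
  have "(\<lambda>n. mean_const * (root_mean (coeff_ratio n) / real n) / ((level_mean pair_count (coeff_radius n) / pair_count (coeff_radius n)) * (pair_count (coeff_radius n) / ?N (coeff_radius n)))) \<longlonglongrightarrow> mean_const * 1 / (mean_const * 1)"
    by (intro tendsto_intros 1 2 3) (use mean_const_pos in auto)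
  then have lim: "(\<lambda>n. mean_const * (root_mean (coeff_ratio n) / real n) / ((level_mean pair_count (coeff_radius n) / pair_count (coeff_radius n)) * (pair_count (coeff_radius n) / ?N (coeff_radius n)))) \<longlonglongrightarrow> 1"
    using mean_const_pos by simp
  have ev1: "eventually (\<lambda>n. pair_count (coeff_radius n) / ?N (coeff_radius n) > 0) sequentially"
    using order_tendstoD(1)[OF 1, of 0] by simp
  have ev2: "eventually (\<lambda>n. level_mean pair_count (coeff_radius n) / pair_count (coeff_radius n) > 0) sequentially"
    using order_tendstoD(1)[OF 2, of 0] mean_const_pos by simp
  have "eventually (\<lambda>n. mean_const * (root_mean (coeff_ratio n) / real n) / ((level_mean pair_count (coeff_radius n) / pair_count (coeff_radius n)) * (pair_count (coeff_radius n) / ?N (coeff_radius n)))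
      = ?N (coeff_radius n) / (real n / mean_const)) sequentially"
    using ev1 ev2
  proof eventually_elim
    case (elim n)
    then have "pair_count (coeff_radius n) \<noteq> 0" "?N (coeff_radius n) \<noteq> 0" "level_mean pair_count (coeff_radius n) \<noteq> 0" by (metis div_0 div_by_0 less_irrefl)+
    then show ?case by (simp add: root_mean_def coeff_radius_def[symmetric] field_simps)
  qed
  with lim show ?thesis by (rule Lim_transform_eventually)
qed

definition count_radius :: "nat \<Rightarrow> real" where "count_radius n = n_plus_inv f (real n / mean_const)"

text \<open>
  The counting function is asymptotic to \<open>n / mean_const\<close> at \<open>coeff_radius n\<close>, and it crosses
  this value for the first time at \<open>count_radius n\<close>; \<open>regularly_varying_squeeze\<close> shows that the
  two points are asymptotically equal.
\<close>
lemma count_radius_asymp: "(\<lambda>n. count_radius n / coeff_radius n) \<longlonglongrightarrow> 1"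
proof (rule ratio_tendsto_1I)
  show "eventually (\<lambda>n. coeff_radius n > 0) sequentially"
    using eventually_ge_at_top[of n0] by eventually_elim (rule coeff_radius_pos)
  fix e :: real assume e: "e > 1"
  have y: "eventually (\<lambda>n. real n / mean_const > 0) sequentially"
    using eventually_gt_at_top[of 0] by eventually_elim (use mean_const_pos in auto)
  have sq: "eventually (\<lambda>n. real (n_plus f (coeff_radius n / e)) < real n / mean_const) sequentially"
    "eventually (\<lambda>n. real n / mean_const < real (n_plus f (e * coeff_radius n))) sequentially"
    by (rule regularly_varying_squeeze[of \<alpha> "\<lambda>r. real (n_plus f r)", OF \<alpha>(1) reg_var coeff_radius_at_top y n_plus_coeff_radius e], assumption)+
  show "eventually (\<lambda>n. coeff_radius n / e \<le> count_radius n \<and> count_radius n \<le> e * coeff_radius n) sequentially"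
    using sq eventually_ge_at_top[of n0]
  proof eventually_elim
    case (elim n)
    have mem: "e * coeff_radius n \<in> {r. r > 0 \<and> real (n_plus f r) \<ge> real n / mean_const}"
      using elim e coeff_radius_pos[of n] by auto
    have "count_radius n \<le> e * coeff_radius n" unfolding count_radius_def n_plus_inv_def
      by (rule cInf_lower[OF mem]) (rule bdd_belowI[of _ 0], auto)
    moreover have "coeff_radius n / e \<le> count_radius n" unfolding count_radius_def n_plus_inv_def
    proof (rule cInf_greatest)
      fix r assume r: "r \<in> {r. r > 0 \<and> real (n_plus f r) \<ge> real n / mean_const}"
      show "coeff_radius n / e \<le> r"
      proof (rule ccontr)
        assume "\<not> coeff_radius n / e \<le> r"
        then have "real (n_plus f r) \<le> real (n_plus f (coeff_radius n / e))"
          using monoD[OF n_plus_mono, of r "coeff_radius n / e"] by simp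
        then show False using elim r by simp
      qed
    qed (use mem in blast)
    ultimately show ?case by simp
  qed
qed

text \<open>
  Both radii are asymptotic inverses of the counting function at levels whose ratio tends to
  1, so the same squeeze applies with \<open>n_plus f (coeff_radius (n + 1))\<close> as the level.
\<close>
lemma coeff_radius_Suc: "(\<lambda>n. coeff_radius (Suc n) / coeff_radius n) \<longlonglongrightarrow> 1"
proof (rule ratio_tendsto_1I)
  show "eventually (\<lambda>n. coeff_radius n > 0) sequentially"
    using eventually_ge_at_top[of n0] by eventually_elim (rule coeff_radius_pos)
  fix e :: real assume e: "e > 1"
  let ?N = "\<lambda>r. real (n_plus f r)"
  define y where "y n = ?N (coeff_radius (Suc n))" for n
  have l1: "(\<lambda>n. ?N (coeff_radius (Suc n)) / (real (Suc n) / mean_const)) \<longlonglongrightarrow> 1"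
    using LIMSEQ_Suc[OF n_plus_coeff_radius] .
  have y: "eventually (\<lambda>n. y n > 0) sequentially"
    using order_tendstoD(1)[OF l1 zero_less_one] unfolding y_def
    by eventually_elim (use mean_const_pos in \<open>auto simp: zero_less_divide_iff zero_less_mult_iff\<close>)
  have "(\<lambda>n. (?N (coeff_radius n) / (real n / mean_const)) / (?N (coeff_radius (Suc n)) / (real (Suc n) / mean_const)) / (real (Suc n) / real n)) \<longlonglongrightarrow> 1 / 1 / 1"
    by (intro tendsto_intros n_plus_coeff_radius l1 LIMSEQ_Suc_n_over_n) auto
  then have l2: "(\<lambda>n. (?N (coeff_radius n) / (real n / mean_const)) / (?N (coeff_radius (Suc n)) / (real (Suc n) / mean_const)) / (real (Suc n) / real n)) \<longlonglongrightarrow> 1"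
    by simp
  have l3: "(\<lambda>n. ?N (coeff_radius n) / y n) \<longlonglongrightarrow> 1"
    using l2
  proof (rule Lim_transform_eventually)
    show "eventually (\<lambda>n. (?N (coeff_radius n) / (real n / mean_const)) / (?N (coeff_radius (Suc n)) / (real (Suc n) / mean_const)) / (real (Suc n) / real n)
        = ?N (coeff_radius n) / y n) sequentially"
      using eventually_gt_at_top[of 0] y
    proof eventually_elim
      case (elim n)
      then show ?case using mean_const_pos unfolding y_def by (simp add: divide_simps)
    qed
  qed
  have sq: "eventually (\<lambda>n. ?N (coeff_radius n / e) < y n) sequentially"
    "eventually (\<lambda>n. y n < ?N (e * coeff_radius n)) sequentially"
    by (rule regularly_varying_squeeze[of \<alpha> ?N, OF \<alpha>(1) reg_var coeff_radius_at_top y l3 e], assumption)+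
  show "eventually (\<lambda>n. coeff_radius n / e \<le> coeff_radius (Suc n) \<and> coeff_radius (Suc n) \<le> e * coeff_radius n) sequentially"
    using sq
  proof eventually_elim
    case (elim n)
    have "coeff_radius n / e \<le> coeff_radius (Suc n)"
      using elim monoD[OF n_plus_mono, of "coeff_radius (Suc n)" "coeff_radius n / e"] unfolding y_def by linarith
    moreover have "coeff_radius (Suc n) \<le> e * coeff_radius n"
      using elim monoD[OF n_plus_mono, of "e * coeff_radius n" "coeff_radius (Suc n)"] unfolding y_def by linarith
    ultimately show ?case by simp
  qed
qed

lemma coeff_ratio_shift: "(\<lambda>n. coeff_ratio n / coeff_ratio (n + j)) \<longlonglongrightarrow> 1"
proof (induction j)
  case 0
  show ?case
    by (rule tendsto_eventually, use eventually_ge_at_top[of n0] in eventually_elim)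
      (use coeff_ratio_pos in \<open>auto simp: less_imp_neq[symmetric]\<close>)
next
  case (Suc j)
  have "(\<lambda>n. coeff_radius (Suc (n + j)) / coeff_radius (n + j)) \<longlonglongrightarrow> 1"
    using LIMSEQ_ignore_initial_segment[OF coeff_radius_Suc, of j] .
  then have "(\<lambda>n. (coeff_ratio n / coeff_ratio (n + j)) / (coeff_radius (Suc (n + j)) / coeff_radius (n + j))\<^sup>2) \<longlonglongrightarrow> 1 / 1\<^sup>2"
    by (intro tendsto_intros Suc) auto
  then have l: "(\<lambda>n. (coeff_ratio n / coeff_ratio (n + j)) / (coeff_radius (Suc (n + j)) / coeff_radius (n + j))\<^sup>2) \<longlonglongrightarrow> 1" by simp
  show ?case using l
  proof (rule Lim_transform_eventually)
    show "eventually (\<lambda>n. (coeff_ratio n / coeff_ratio (n + j)) / (coeff_radius (Suc (n + j)) / coeff_radius (n + j))\<^sup>2 = coeff_ratio n / coeff_ratio (n + Suc j)) sequentially"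
      using eventually_ge_at_top[of n0]
    proof eventually_elim
      case (elim n)
      have "coeff_ratio (n + j) > 0" "coeff_ratio (Suc (n + j)) > 0" using elim by (auto intro: coeff_ratio_pos)
      then show ?case by (simp add: coeff_radius_def power_divide field_simps)
    qed
  qed
qed

text \<open>
  The factor by which the ratio of the normalised Taylor coefficients of the rescaled
  derivative and of the cosine changes from index \<open>j\<close> to \<open>j + 1\<close>; see \<open>taylor_ratio\<close>.
\<close>
definition ratio_step :: "nat \<Rightarrow> nat \<Rightarrow> real" where
  "ratio_step n j = scale_seq f \<alpha> n * ((2 * (real n + real j) + 2) * (2 * (real n + real j) + 1)) / coeff_ratio (n + j)"

lemma scale_seq_alt: "scale_seq f \<alpha> n = (count_radius n / (2 * real n))\<^sup>2"
proof -
  have "2 * real n / (pi * \<alpha> * (1 / sin (pi * \<alpha> / 2))) = real n / mean_const"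
    by (simp add: mean_const_def)
  then show ?thesis unfolding scale_seq_def count_radius_def by simp
qed

lemma scale_seq_asymp: "(\<lambda>n. scale_seq f \<alpha> n * (4 * (real n)\<^sup>2) / coeff_ratio n) \<longlonglongrightarrow> 1"
proof -
  have l: "(\<lambda>n. (count_radius n / coeff_radius n)\<^sup>2) \<longlonglongrightarrow> 1" using tendsto_power[OF count_radius_asymp, of 2] by simp
  show ?thesis using l
  proof (rule Lim_transform_eventually)
    show "eventually (\<lambda>n. (count_radius n / coeff_radius n)\<^sup>2 = scale_seq f \<alpha> n * (4 * (real n)\<^sup>2) / coeff_ratio n) sequentially"
      using eventually_ge_at_top[of "max n0 1"]
    proof eventually_elim
      case (elim n)
      have "coeff_ratio n > 0" using elim coeff_ratio_pos by simp
      then show ?case using elim by (simp add: scale_seq_alt coeff_radius_def power_divide power_mult_distrib field_simps)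
    qed
  qed
qed

lemma ratio_step_tendsto: "(\<lambda>n. ratio_step n j) \<longlonglongrightarrow> 1"
proof -
  have "(\<lambda>n. (2 * (real n + real j) + 2) * (2 * (real n + real j) + 1) / (4 * (real n)\<^sup>2)) \<longlonglongrightarrow> 1"
    by real_asymp
  then have l: "(\<lambda>n. scale_seq f \<alpha> n * (4 * (real n)\<^sup>2) / coeff_ratio n *
      ((2 * (real n + real j) + 2) * (2 * (real n + real j) + 1) / (4 * (real n)\<^sup>2)) * (coeff_ratio n / coeff_ratio (n + j))) \<longlonglongrightarrow> 1 * 1 * 1"
    by (intro tendsto_mult scale_seq_asymp coeff_ratio_shift)
  show ?thesis
  proof (rule Lim_transform_eventually[THEN tendsto_eq_rhs, OF l])
    show "eventually (\<lambda>n. scale_seq f \<alpha> n * (4 * (real n)\<^sup>2) / coeff_ratio n *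
      ((2 * (real n + real j) + 2) * (2 * (real n + real j) + 1) / (4 * (real n)\<^sup>2)) * (coeff_ratio n / coeff_ratio (n + j)) = ratio_step n j) sequentially"
      using eventually_ge_at_top[of "max n0 1"]
    proof eventually_elim
      case (elim n)
      have nz: "coeff_ratio n \<noteq> 0" "real n \<noteq> 0" using elim coeff_ratio_pos[of n] by auto
      have "A * (4 * x\<^sup>2) / Q * (B / (4 * x\<^sup>2)) * (Q / R) = A * B / R" if "Q \<noteq> 0" "x \<noteq> 0" for A B Q R x :: real
        using that by simp
      from this[OF nz] show ?case unfolding ratio_step_def .
    qed
  qed simp
qed

text \<open>
  For \<open>m = n + j\<close>, monotonicity of \<open>root_mean t / t\<close> gives
  \<open>m / coeff_ratio m \<le> root_mean (coeff_ratio n) / coeff_ratio n \<le> (n + 1) / coeff_ratio n\<close>, a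
  bound with the same \<open>n\<close> as in the scaling factor. The rest is \<open>scale_seq_asymp\<close> and crude
  estimates. A bound that is linear in \<open>j\<close>, and not quadratic, is what leaves the series
  dominated by that of an entire function.
\<close>
lemma ratio_step_bound: "eventually (\<lambda>n. \<forall>j. 0 \<le> ratio_step n j \<and> ratio_step n j \<le> 12 * real (Suc j)) sequentially"
proof -
  have "eventually (\<lambda>n. scale_seq f \<alpha> n * (4 * (real n)\<^sup>2) / coeff_ratio n < 2) sequentially"
    using order_tendstoD(2)[OF scale_seq_asymp, of 2] by simp
  then show ?thesis using eventually_ge_at_top[of "max n0 1"]
  proof eventually_elim
    case (elim n)
    show ?case
    proof
      fix j
      define m where "m = n + j"
      have n: "real n \<ge> 1" "real m = real n + real j" using elim by (auto simp: m_def)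
      have qn: "coeff_ratio n > 0" and qm: "coeff_ratio m > 0" using elim coeff_ratio_pos by (auto simp: m_def)
      have qnm: "coeff_ratio n \<le> coeff_ratio m" using elim by (intro coeff_ratio_mono) (auto simp: m_def)
      have a0: "scale_seq f \<alpha> n \<ge> 0" by (simp add: scale_seq_alt)
      have "real m \<le> root_mean (coeff_ratio m)" using elim by (intro mean_at_coeff_ratio) (auto simp: m_def)
      also have "\<dots> \<le> max 1 (coeff_ratio m / coeff_ratio n) * root_mean (coeff_ratio n)" by (rule root_mean_scale[OF qn qm])
      also have "max 1 (coeff_ratio m / coeff_ratio n) = coeff_ratio m / coeff_ratio n" using qnm qn by (simp add: max_def)
      also have "coeff_ratio m / coeff_ratio n * root_mean (coeff_ratio n) \<le> coeff_ratio m / coeff_ratio n * real (Suc n)"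
        using elim qn qm by (intro mult_left_mono mean_at_coeff_ratio) auto
      finally have "coeff_ratio n * real m \<le> real (Suc n) * coeff_ratio m"
        using qn by (simp add: field_simps)
      moreover have "1 / b \<le> y / z" if "b > 0" "z > 0" "z \<le> y * b" for b y z :: real
        using that by (simp add: field_simps)
      ultimately have mq: "1 / coeff_ratio m \<le> real (Suc n) / (coeff_ratio n * real m)"
        using qn qm n by simp
      have "ratio_step n j = scale_seq f \<alpha> n * ((2 * real m + 2) * (2 * real m + 1)) * (1 / coeff_ratio m)"
        unfolding ratio_step_def n(2) by (simp add: m_def)
      also have "\<dots> \<le> scale_seq f \<alpha> n * (real m * (4 * real m + 8)) * (real (Suc n) / (coeff_ratio n * real m))"
      proof -
        have "real m \<ge> 1" using n by simp
        then have "(2 * real m + 2) * (2 * real m + 1) \<le> real m * (4 * real m + 8)"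
          by (simp add: algebra_simps)
        then have "scale_seq f \<alpha> n * ((2 * real m + 2) * (2 * real m + 1))
            \<le> scale_seq f \<alpha> n * (real m * (4 * real m + 8))"
          by (rule mult_left_mono[OF _ a0])
        from mult_mono[OF this mq] show ?thesis using qm a0 by simp
      qed
      also have "\<dots> = (scale_seq f \<alpha> n * (4 * (real n)\<^sup>2) / coeff_ratio n) * ((real m + 2) / real n * (real (Suc n) / real n))"
      proof -
        have alg: "A * (m * (4 * m + 8)) * (B / (Q * m)) = A * (4 * x\<^sup>2) / Q * ((m + 2) / x * (B / x))"
          if "m \<noteq> 0" "x \<noteq> 0" "Q \<noteq> 0" for A B Q m x :: real
          using that by (simp add: field_simps power2_eq_square)
        show ?thesis by (rule alg) (use n qn in auto)
      qed
      also have "\<dots> \<le> 2 * ((real j + 3) * 2)"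
      proof (intro mult_mono)
        show "(real m + 2) / real n \<le> real j + 3"
        proof -
          have "real j * 1 \<le> real j * real n" using n by (intro mult_left_mono) auto
          then show ?thesis using n by (simp add: divide_simps) (simp add: algebra_simps)
        qed
        show "real (Suc n) / real n \<le> 2" using n by (simp add: divide_simps)
      qed (use elim qn a0 n in auto)
      also have "\<dots> \<le> 12 * real (Suc j)" by simp
      finally show "0 \<le> ratio_step n j \<and> ratio_step n j \<le> 12 * real (Suc j)"
        using a0 qm by (simp add: ratio_step_def m_def)
    qed
  qed
qed

definition deriv_ratio :: "nat \<Rightarrow> nat \<Rightarrow> real" where
  "deriv_ratio n k = (\<Prod>j<k. ratio_step n j)"

lemma taylor_ratio:
  assumes "n \<ge> n0"
  shows "fact (2 * (n + k)) * taylor_abs (n + k) / (fact (2 * n) * taylor_abs n) * scale_seq f \<alpha> n ^ k = deriv_ratio n k"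
proof (induction k)
  case 0
  then show ?case using taylor_abs_pos[OF assms] by (simp add: deriv_ratio_def)
next
  case (Suc k)
  have p: "taylor_abs n > 0" "taylor_abs (n + k) > 0" "taylor_abs (Suc (n + k)) > 0"
    using assms taylor_abs_pos by auto
  have f2: "fact (2 * (n + Suc k)) = ((2 * (real n + real k) + 2) * (2 * (real n + real k) + 1)) * fact (2 * (n + k))"
  proof -
    have "2 * (n + Suc k) = Suc (Suc (2 * (n + k)))" by simp
    then show ?thesis by (simp only: fact_Suc of_nat_mult) (simp add: algebra_simps)
  qed
  have "deriv_ratio n (Suc k) = deriv_ratio n k * ratio_step n k" by (simp add: deriv_ratio_def)
  also have "ratio_step n k = scale_seq f \<alpha> n * ((2 * (real n + real k) + 2) * (2 * (real n + real k) + 1)) *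
      taylor_abs (Suc (n + k)) / taylor_abs (n + k)"
    by (simp add: ratio_step_def coeff_ratio_def)
  also have "deriv_ratio n k * \<dots> = fact (2 * (n + Suc k)) * taylor_abs (n + Suc k) / (fact (2 * n) * taylor_abs n) * scale_seq f \<alpha> n ^ Suc k"
    unfolding Suc[symmetric] f2 using p by simp
  finally show ?case by simp
qed

lemma derivative_series:
  assumes n: "n \<ge> n0"
  shows "(\<lambda>k. (-1) ^ k * of_real (deriv_ratio n k) * z ^ (2 * k) / fact (2 * k)) sums
     (1 / (deriv ^^ (2 * n)) f 0 * (deriv ^^ (2 * n)) f (of_real (sqrt (scale_seq f \<alpha> n)) * z))"
proof -
  define a where "a = scale_seq f \<alpha> n"
  have a0: "a \<ge> 0" by (simp add: a_def scale_seq_alt)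
  define w where "w = of_real (sqrt a) * z"
  define g where "g = (deriv ^^ (2 * n)) f"
  have g: "g holomorphic_on UNIV" unfolding g_def by (intro holomorphic_higher_deriv entire) auto
  have gm: "(deriv ^^ m) g 0 = (deriv ^^ (m + 2 * n)) f 0" for m by (simp add: g_def funpow_add)
  have g0: "g 0 = f \<i> * fact (2 * n) * (-1) ^ n * of_real (taylor_abs n)"
    unfolding g_def by (rule higher_deriv_even)
  have g0nz: "g 0 \<noteq> 0" using g0 f_i_nonzero taylor_abs_pos[OF n] by simp
  have "(\<lambda>m. (deriv ^^ m) g 0 / fact m * (w - 0) ^ m) sums g w"
    by (rule holomorphic_power_series[of g 0 "norm w + 1"]) (auto intro: holomorphic_on_subset[OF g])
  then have "(\<lambda>m. (deriv ^^ m) g 0 / fact m * w ^ m) sums g w" by simp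
  then have "(\<lambda>k. (deriv ^^ (2 * k)) g 0 / fact (2 * k) * w ^ (2 * k)) sums g w"
  proof (subst sums_mono_reindex)
    show "(deriv ^^ m) g 0 / fact m * w ^ m = 0" if "m \<notin> range (\<lambda>k. 2 * k)" for m
    proof -
      have "odd m" using that by (auto elim!: evenE)
      then show ?thesis unfolding gm using higher_deriv_odd[of "m + 2 * n"] by simp
    qed
  qed (auto simp: strict_mono_def)
  then have "(\<lambda>k. (1 / g 0) * ((deriv ^^ (2 * k)) g 0 / fact (2 * k) * w ^ (2 * k))) sums (1 / g 0 * g w)"
    by (rule sums_mult)
  also have "(\<lambda>k. (1 / g 0) * ((deriv ^^ (2 * k)) g 0 / fact (2 * k) * w ^ (2 * k)))
      = (\<lambda>k. (-1) ^ k * of_real (deriv_ratio n k) * z ^ (2 * k) / fact (2 * k))"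
  proof
    fix k
    have "(deriv ^^ (2 * k)) g 0 = f \<i> * fact (2 * (n + k)) * (-1) ^ (n + k) * of_real (taylor_abs (n + k))"
      unfolding gm using higher_deriv_even[of "n + k"] by (simp add: algebra_simps)
    moreover have "w ^ (2 * k) = of_real (a ^ k) * z ^ (2 * k)"
      unfolding w_def power_mult_distrib power_mult[of _ 2 k] using a0
      by (simp only: of_real_power[symmetric] real_sqrt_pow2)
    moreover have "complex_of_real (deriv_ratio n k) =
       fact (2 * (n + k)) * of_real (taylor_abs (n + k)) / (fact (2 * n) * of_real (taylor_abs n)) * of_real (a ^ k)"
      unfolding taylor_ratio[OF n, of k, symmetric] a_def by simp
    ultimately show "(1 / g 0) * ((deriv ^^ (2 * k)) g 0 / fact (2 * k) * w ^ (2 * k))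
      = (-1) ^ k * of_real (deriv_ratio n k) * z ^ (2 * k) / fact (2 * k)"
      unfolding g0 using f_i_nonzero by (simp add: power_add)
  qed
  finally show ?thesis by (simp add: g_def w_def a_def)
qed

lemma cos_series: "(\<lambda>k. (-1) ^ k * z ^ (2 * k) / fact (2 * k)) sums cos (z::complex)"
proof -
  have "(\<lambda>k. cos_coeff (2 * k) *\<^sub>R z ^ (2 * k)) sums cos z"
  proof (subst sums_mono_reindex)
    show "cos_coeff m *\<^sub>R z ^ m = 0" if "m \<notin> range (\<lambda>k. 2 * k)" for m
    proof -
      have "odd m" using that by (auto elim!: evenE)
      then show ?thesis by (simp add: cos_coeff_def)
    qed
  qed (auto simp: strict_mono_def cos_converges)
  then show ?thesis by (simp add: cos_coeff_def scaleR_conv_of_real)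
qed

lemma deriv_ratio_tendsto: "(\<lambda>n. deriv_ratio n k) \<longlonglongrightarrow> 1"
proof -
  have "(\<lambda>n. \<Prod>j<k. ratio_step n j) \<longlonglongrightarrow> (\<Prod>j<k. 1)" by (intro tendsto_prod ratio_step_tendsto)
  then show ?thesis by (simp add: deriv_ratio_def)
qed

lemma deriv_ratio_bound: "eventually (\<lambda>n. \<forall>k. 0 \<le> deriv_ratio n k \<and> deriv_ratio n k \<le> 12 ^ k * fact k) sequentially"
  using ratio_step_bound
proof eventually_elim
  case (elim n)
  show ?case
  proof
    fix k
    have "deriv_ratio n k \<le> (\<Prod>j<k. 12 * real (Suc j))"
      unfolding deriv_ratio_def using elim by (intro prod_mono) auto
    also have "\<dots> = 12 ^ k * fact k"
      by (induction k) (auto simp: algebra_simps)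
    finally show "0 \<le> deriv_ratio n k \<and> deriv_ratio n k \<le> 12 ^ k * fact k"
      unfolding deriv_ratio_def using elim by (auto intro!: prod_nonneg)
  qed
qed

text \<open>
  By \<open>derivative_series\<close> and \<open>cos_series\<close>, on the disc of radius \<open>R\<close> the difference is at most
  \<open>(\<Sum>k. \<bar>deriv_ratio n k - 1\<bar> * R ^ (2 * k) / (2 k)!)\<close>, a number independent of \<open>z\<close>, to which
  Tannery's theorem applies.
\<close>
lemma derivatives_tend_to_cos:
  assumes "compact K"
  shows "uniform_limit K
            (\<lambda>n z. 1 / (deriv ^^ (2 * n)) f 0 *
                    (deriv ^^ (2 * n)) f (of_real (sqrt (scale_seq f \<alpha> n)) * z))
            cos sequentially"
proof -
  obtain R where R: "R > 0" "\<And>z. z \<in> K \<Longrightarrow> norm z \<le> R"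
    using compact_imp_bounded[OF assms] unfolding bounded_pos by blast
  define a where "a k n = \<bar>deriv_ratio n k - 1\<bar> * R ^ (2 * k) / fact (2 * k)" for k n
  define B where "B k = (12 * R\<^sup>2) ^ k /\<^sub>R fact k + (R\<^sup>2) ^ k /\<^sub>R fact k" for k
  have "eventually (\<lambda>n. \<forall>k. norm (a k n) \<le> B k) sequentially"
    using deriv_ratio_bound
  proof eventually_elim
    case (elim n)
    show ?case
    proof
      fix k
      \<comment> \<open>The binomial coefficient \<open>2 * k choose k\<close> is at least 1.\<close>
      have ff: "fact k * fact k \<le> (fact (2 * k) :: real)"
      proof -
        have "fact k * fact k dvd (fact (k + k) :: nat)" by (rule fact_fact_dvd_fact)
        then have "fact k * fact k \<le> (fact (k + k) :: nat)" by (rule dvd_imp_le) simp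
        then have "real (fact k * fact k) \<le> real (fact (k + k))" by (simp only: of_nat_le_iff)
        then show ?thesis by (simp add: mult_2)
      qed
      have f1: "(1::real) \<le> fact k" by (rule fact_ge_1)
      have "\<bar>deriv_ratio n k - 1\<bar> \<le> 12 ^ k * fact k + 1 * fact k"
      proof -
        have "(0::real) \<le> 12 ^ k * fact k" by simp
        moreover have "0 \<le> deriv_ratio n k" "deriv_ratio n k \<le> 12 ^ k * fact k" using elim by auto
        ultimately show ?thesis using f1 by linarith
      qed
      then have "a k n \<le> (12 ^ k * fact k + 1 * fact k) * R ^ (2 * k) / (fact k * fact k)"
        unfolding a_def using R ff by (intro frac_le mult_right_mono mult_nonneg_nonneg) auto
      also have "\<dots> = B k"
        unfolding B_def power_mult by (simp add: power_mult_distrib field_simps)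
      finally show "norm (a k n) \<le> B k" using R by (simp add: a_def)
    qed
  qed
  then have bound: "eventually (\<lambda>(k, n). norm (a k n) \<le> B k) (at_top \<times>\<^sub>F sequentially)"
    unfolding eventually_prod_filter
    by (intro exI[of _ "\<lambda>_. True"] exI[of _ "\<lambda>n. \<forall>k. norm (a k n) \<le> B k"]) auto
  have lim: "(\<lambda>n. a k n) \<longlonglongrightarrow> 0" for k
  proof -
    have "(\<lambda>n. \<bar>deriv_ratio n k - 1\<bar> * R ^ (2 * k) / fact (2 * k)) \<longlonglongrightarrow> \<bar>1 - 1\<bar> * R ^ (2 * k) / fact (2 * k)"
      by (intro tendsto_intros deriv_ratio_tendsto) auto
    then show ?thesis by (simp add: a_def)
  qed
  have sB: "summable B" unfolding B_def by (intro summable_add summable_exp_generic)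
  note tan = tannerys_theorem[OF lim bound sB sequentially_bot]
  have sa: "eventually (\<lambda>n. summable (\<lambda>k. norm (a k n))) sequentially" using tan by blast
  have slim: "(\<lambda>n. suminf (\<lambda>k. a k n)) \<longlonglongrightarrow> 0" using tan by simp
  show ?thesis
  proof (rule uniform_limitI)
    fix e :: real assume e: "e > 0"
    have "eventually (\<lambda>n. suminf (\<lambda>k. a k n) < e) sequentially"
      using order_tendstoD(2)[OF slim e] .
    then show "eventually (\<lambda>n. \<forall>z\<in>K. dist (1 / (deriv ^^ (2 * n)) f 0 *
                    (deriv ^^ (2 * n)) f (of_real (sqrt (scale_seq f \<alpha> n)) * z)) (cos z) < e) sequentially"
      using sa eventually_ge_at_top[of n0]
    proof eventually_elim
      case (elim n)
      show ?case
      proof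
        fix z assume z: "z \<in> K"
        let ?v = "1 / (deriv ^^ (2 * n)) f 0 *
                    (deriv ^^ (2 * n)) f (of_real (sqrt (scale_seq f \<alpha> n)) * z)"
        let ?d = "\<lambda>k. (-1) ^ k * of_real (deriv_ratio n k) * z ^ (2 * k) / fact (2 * k) - (-1) ^ k * z ^ (2 * k) / fact (2 * k)"
        have sm: "?d sums (?v - cos z)"
          by (intro sums_diff derivative_series cos_series) (use elim in simp)
        have nd: "norm (?d k) \<le> norm (a k n)" for k
        proof -
          have "?d k = (-1) ^ k * of_real (deriv_ratio n k - 1) * z ^ (2 * k) / fact (2 * k)"
            by (simp add: algebra_simps diff_divide_distrib)
          then have "norm (?d k) = \<bar>deriv_ratio n k - 1\<bar> * norm z ^ (2 * k) / fact (2 * k)"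
            by (simp only: norm_divide norm_mult norm_power norm_minus_cancel norm_one power_one norm_of_real norm_fact mult_1)
          also have "\<dots> \<le> a k n" unfolding a_def
            using R(2)[OF z] by (intro divide_right_mono mult_left_mono power_mono) auto
          finally show ?thesis by simp
        qed
        have "norm (?v - cos z) = norm (suminf ?d)" using sums_unique[OF sm] by simp
        also have "\<dots> \<le> (\<Sum>k. norm (a k n))"
          by (rule norm_suminf_le[OF nd]) (use elim in simp)
        also have "\<dots> = suminf (\<lambda>k. a k n)" using R by (simp add: a_def)
        also have "\<dots> < e" using elim by simp
        finally show "dist ?v (cos z) < e" by (simp add: dist_norm)
      qed
    qed
  qed
qed

end

theorem theorem2p2:
  fixes f :: "complex \<Rightarrow> complex" and \<alpha> :: real
  assumes entire: "f holomorphic_on UNIV"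
    and even: "\<And>z. f (- z) = f z"
    and order: "entire_order f < 2"
    and real_on_reals: "\<And>x::real. f (of_real x) \<in> \<real>"
    and only_real_roots: "\<And>z. f z = 0 \<Longrightarrow> z \<in> \<real>"
    and alpha: "\<alpha> \<in> {0<..<2}"
    and reg_var: "\<And>x::real. x > 0 \<Longrightarrow>
          ((\<lambda>r. real (n_plus f (x * r)) / real (n_plus f r)) \<longlongrightarrow> x powr \<alpha>) at_top"
  shows "\<forall>K. compact K \<longrightarrow>
          uniform_limit K
            (\<lambda>n z. 1 / (deriv ^^ (2 * n)) f 0 *
                    (deriv ^^ (2 * n)) f (of_real (sqrt (scale_seq f \<alpha> n)) * z))
            cos sequentially"
proof -
  interpret even_real_rooted f \<alpha>
    using assms by unfold_locales auto
  show ?thesis using derivatives_tend_to_cos by blast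
qed

end
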